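(* Let $\tilde w\in\mathrm{FC}(\tilde C_n)$ belong to $(\mathrm{ZZ})$ or $(\mathrm{PZZ})$. Then $\mathtt{dec}_Z(\tilde w)=\tilde\theta(\tilde b_{\tilde w})$.
   Context: Let $n\ge 2$. $\tilde C_n$ is the Coxeter group with generators $\tilde s_1,\dots,\tilde s_{n+1}$ whose Coxeter graph is the path $\tilde s_1-\cdots-\tilde s_{n+1}$, the edges $\{\tilde s_1,\tilde s_2\}$, $\{\tilde s_n,\tilde s_{n+1}\}$ having label $4$ and the others label $3$; $A_{n+1}$ has generators $s_1,\dots,s_{n+1}$ and Coxeter graph the path with all labels $3$. $\mathrm{FC}(\cdot)$ is the set of fully commutative elements (any two reduced expressions are related by commutation relations only). The heap $H(w)$ of a FC element $w$ with reduced expression $s_{a_1}\cdots s_{a_l}$ is the poset on $\{1,\dots,l\}$ generated by $i\prec j$ if $i<j$ and $s_{a_i},s_{a_j}$ do not commute, with $i$ labeled $s_{a_i}$; it is drawn from top to bottom ($i$ above $j$ if $i\prec j$). FAMILIES. $\tilde w\in(\mathrm{ZZ})$ if $\tilde w$ has a reduced expression which is a finite factor of the infinite word $(\tilde s_1\tilde s_2\cdots\tilde s_n\tilde s_{n+1}\tilde s_n\cdots\tilde s_2)^\infty$ and some $\tilde s_i$, $2\le i\le n$, occurs at least three times. $\tilde w\in(\mathrm{PZZ})$ if $\tilde w$ has a reduced expression which is a finite factor of the same infinite word, contains the factors $\tilde s_2\tilde s_1\tilde s_2$ and $\tilde s_n\tilde s_{n+1}\tilde s_n$, and in which every $\tilde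 s_i$, $2\le i\le n$, occurs fewer than three times. TEMPERLEY-LIEB ALGEBRA. $\mathrm{TL}(\tilde C_n)$ is the unital $\mathbb Z[\delta]$-algebra generated by $\tilde b_1,\dots,\tilde b_{n+1}$ with relations $\tilde b_i^2=\delta\tilde b_i$; $\tilde b_i\tilde b_j=\tilde b_j\tilde b_i$ if $|i-j|>1$; $\tilde b_i\tilde b_j\tilde b_i=\tilde b_i$ if $|i-j|=1$, $i,j\in\{2,\dots,n\}$; $\tilde b_i\tilde b_j\tilde b_i\tilde b_j=2\tilde b_i\tilde b_j$ if $\{i,j\}=\{1,2\}$ or $\{n,n+1\}$. For $\tilde w=\tilde s_{i_1}\cdots\tilde s_{i_k}$ reduced and FC, $\tilde b_{\tilde w}=\tilde b_{i_1}\cdots\tilde b_{i_k}$. DIAGRAMS. The standard $(n+2)$-box has nodes $1,\dots,n+2$ on the north face and $1',\dots,(n+2)'$ on the south face, left to right. A pseudo diagram is an isotopy class of finitely many disjoint curves (edges) in the box, joining the nodes in pairs or closed (loops); an edge is propagating if it joins the two faces; $\mathbf a(d)$ is the number of non-propagating edges on the north face. The product $d'd$ places $d'$ on top of $d$. The simple diagram $d_i$ has edges $(i,i+1)$, $(i',(i+1)')$ and all other edges vertical $(j,j')$. Modulo removing a loop with a factor $\delta$, for $w=s_{i_1}\cdots s_{i_k}\in\mathrm{FC}(A_{n+1})$ put $d_w=d_{i_1}\cdots d_{i_k}$; $w\mapsto d_w$ is a bijection onto loop-free diagrams. For $\tilde w=\tilde s_{i_1}\cdots\tilde s_{i_k}\in\mathrm{FC}(\tilde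 C_n)$ the element $\tau(\tilde w)\in\mathrm{FC}(A_{n+1})$ is defined by $d_{i_1}\cdots d_{i_k}=\delta^{\alpha}d_{\tau(\tilde w)}$, $\alpha\ge0$. For $\tilde w\in(\mathrm{ZZ})\cup(\mathrm{PZZ})$ one has $\mathbf a(d_{\tau(\tilde w)})=1$. DECORATED DIAGRAMS. Edges may carry finite words in the decorations $\bullet,\blacktriangle$ (black), $\circ,\vartriangle$ (white), read from north to south on propagating edges and from the left node to the right node on the others; no decorations are allowed if $\mathbf a(d)=0$; all decorated edges must be simultaneously deformable so as to take black decorations to the left wall and white ones to the right wall without crossing other edges. The word on an edge is a single block, except on propagating edges when $\mathbf a(d)=1$: there words are split into blocks whose relative vertical positions are part of the data; decorations on propagating edges lie below those on the north non-propagating edge and above those on the south one; no decoration on another propagating edge lies in the vertical range of a block; adjacent blocks are conjoined whenever this is compatible with these rules. Diagrams are taken up to isotopy preserving relative vertical positions of blocks. They are multiplied by concatenation, over $\mathbb Z[\delta]$, modulo the following relations for adjacent decorations in a block: $\bullet\bullet=\blacktriangle$, $\bullet\blacktriangle=\blacktriangle\bullet=2\bullet$, $\circ\circ=\vartriangle$, $\circ\vartriangle=\vartriangle\circ=2\circ$; and a loop that is undecorated, or carries only one $\blacktriangle$, or only one $\vartriangle$, equals $\delta$. $\mathbb D(\tilde C_n)$ is the subalgebra generated by $\tilde d_1,\dots,\tilde d_{n+1}$, where $\tilde d_i=d_i$ for $2\le i\le n$, $\tilde d_1$ is $d_1$ with one $\bullet$ on each of $(1,2)$, $(1',2')$, and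 $\tilde d_{n+1}$ is $d_{n+1}$ with one $\circ$ on each of $(n+1,n+2)$, $((n+1)',(n+2)')$. $\tilde\theta:\mathrm{TL}(\tilde C_n)\to\mathbb D(\tilde C_n)$ is the algebra morphism with $\tilde b_i\mapsto\tilde d_i$. $\mathtt{dec}_Z$. Let $\tilde w\in(\mathrm{ZZ})\cup(\mathrm{PZZ})$, with first letter $\tilde s_i$ and last letter $\tilde s_j$. Start from $d_{\tau(\tilde w)}$. Add a $\blacktriangle$ (resp. $\vartriangle$) on the first (resp. last) propagating edge, from the left, for each occurrence of $\tilde s_1$ (resp. $\tilde s_{n+1}$) in $H(\tilde w)$. If $\tilde s_i=\tilde s_1$ (resp. $\tilde s_{n+1}$), replace the highest $\blacktriangle$ on the first (resp. highest $\vartriangle$ on the last) propagating edge by a $\bullet$ (resp. $\circ$) and add a $\bullet$ to the edge $(1,2)$ (resp. a $\circ$ to $(n+1,n+2)$). If $\tilde s_j=\tilde s_1$ (resp. $\tilde s_{n+1}$), replace the lowest $\blacktriangle$ on the first (resp. lowest $\vartriangle$ on the last) propagating edge by a $\bullet$ (resp. $\circ$) and add a $\bullet$ to the edge $(1',2')$ (resp. a $\circ$ to $((n+1)',(n+2)')$). Give the black and white decorations on propagating edges vertical positions compatible with the relative order of the corresponding nodes labeled $\tilde s_1$ and $\tilde s_{n+1}$ in $H(\tilde w)$. The result is $\mathtt{dec}_Z(\tilde w)$. *)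

theory Defs
  imports
    "HOL-Library.Poly_Mapping"
    "HOL-Library.Multiset"
    "HOL-Library.Sublist"
    "HOL-Computational_Algebra.Polynomial"
    "HOL-Algebra.QuotRing"
    "HOL-Algebra.Module"
begin

section \<open>Coxeter groups and fully commutative elements\<close>

text \<open>A Coxeter system is given by its set \<open>I\<close> of generators and its Coxeter matrix \<open>m\<close>
  (with \<open>m s s = 1\<close>; all entries are finite here).  The group is presented by the relations
  \<open>(s t)^(m s t) = 1\<close>, and its elements are the classes of words in the generators.\<close>

inductive cox_eq :: "nat set \<Rightarrow> (nat \<Rightarrow> nat \<Rightarrow> nat) \<Rightarrow> nat list \<Rightarrow> nat list \<Rightarrow> bool"
  for I m where
  rel: "\<lbrakk>u \<in> lists I; v \<in> lists I; s \<in> I; t \<in> I\<rbrakk>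
      \<Longrightarrow> cox_eq I m (u @ concat (replicate (m s t) [s, t]) @ v) (u @ v)"
| refl: "u \<in> lists I \<Longrightarrow> cox_eq I m u u"
| sym: "cox_eq I m u v \<Longrightarrow> cox_eq I m v u"
| trans: "\<lbrakk>cox_eq I m u v; cox_eq I m v w\<rbrakk> \<Longrightarrow> cox_eq I m u w"

definition cox_group :: "nat set \<Rightarrow> (nat \<Rightarrow> nat \<Rightarrow> nat) \<Rightarrow> nat list set set" where
  "cox_group I m = lists I // {(u, v). cox_eq I m u v}"

definition reduced_exprs :: "nat list set \<Rightarrow> nat list set" where
  "reduced_exprs w = {a \<in> w. \<forall>b\<in>w. length a \<le> length b}"

definition reduced_expr :: "nat list set \<Rightarrow> nat list" where
  "reduced_expr w = (SOME a. a \<in> reduced_exprs w)"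

definition comm_step :: "(nat \<Rightarrow> nat \<Rightarrow> nat) \<Rightarrow> nat list \<Rightarrow> nat list \<Rightarrow> bool" where
  "comm_step m a b \<longleftrightarrow> (\<exists>u v s t. m s t = 2 \<and> a = u @ [s, t] @ v \<and> b = u @ [t, s] @ v)"

definition FC :: "nat set \<Rightarrow> (nat \<Rightarrow> nat \<Rightarrow> nat) \<Rightarrow> nat list set set" where
  "FC I m = {w \<in> cox_group I m.
     \<forall>a\<in>reduced_exprs w. \<forall>b\<in>reduced_exprs w. (comm_step m)\<^sup>*\<^sup>* a b}"

definition mC :: "nat \<Rightarrow> nat \<Rightarrow> nat \<Rightarrow> nat" where
  "mC n i j = (if i = j then 1
     else if {i, j} = {1, 2} \<or> {i, j} = {n, n + 1} then 4
     else if j = i + 1 \<or> i = j + 1 then 3 else 2)"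

definition mA :: "nat \<Rightarrow> nat \<Rightarrow> nat" where
  "mA i j = (if i = j then 1 else if j = i + 1 \<or> i = j + 1 then 3 else 2)"

definition FC_C :: "nat \<Rightarrow> nat list set set" where
  "FC_C n = FC {1..n + 1} (mC n)"

definition FC_A :: "nat \<Rightarrow> nat list set set" where
  "FC_A n = FC {1..n + 1} mA"

text \<open>The strict order of the heap of the expression \<open>a\<close>; positions in \<open>a\<close> count from \<open>0\<close>.\<close>

definition heap_less :: "(nat \<Rightarrow> nat \<Rightarrow> nat) \<Rightarrow> nat list \<Rightarrow> nat \<Rightarrow> nat \<Rightarrow> bool" where
  "heap_less m a = (\<lambda>p q. p < q \<and> q < length a \<and> m (a ! p) (a ! q) \<ge> 3)\<^sup>+\<^sup>+"

definition zigzag_factor :: "nat \<Rightarrow> nat list \<Rightarrow> bool" where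
  "zigzag_factor n a \<longleftrightarrow>
     (\<exists>k. sublist a (concat (replicate k ([1..<n + 2] @ rev [2..<n + 1]))))"

definition ZZ :: "nat \<Rightarrow> nat list set \<Rightarrow> bool" where
  "ZZ n w \<longleftrightarrow> (\<exists>a\<in>reduced_exprs w. zigzag_factor n a \<and> (\<exists>i\<in>{2..n}. count_list a i \<ge> 3))"

definition PZZ :: "nat \<Rightarrow> nat list set \<Rightarrow> bool" where
  "PZZ n w \<longleftrightarrow> (\<exists>a\<in>reduced_exprs w. zigzag_factor n a
     \<and> sublist [2, 1, 2] a \<and> sublist [n, n + 1, n] a \<and> (\<forall>i\<in>{2..n}. count_list a i < 3))"

definition zigzag_expr :: "nat \<Rightarrow> nat list set \<Rightarrow> nat list" where
  "zigzag_expr n w = (SOME a. a \<in> reduced_exprs w \<and> zigzag_factor n a)"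


section \<open>Algebras over the polynomial ring in \<open>\<delta>\<close>\<close>

abbreviation delta :: "int poly" where
  "delta \<equiv> [:0, 1:]"

text \<open>The free module on the set \<open>S\<close>, with the bilinear extension of the operation \<open>f\<close>.\<close>

definition free_alg :: "'a set \<Rightarrow> ('a \<Rightarrow> 'a \<Rightarrow> 'a) \<Rightarrow> 'a \<Rightarrow> (int poly, 'a \<Rightarrow>\<^sub>0 int poly) module" where
  "free_alg S f e =
    \<lparr>carrier = {x. Poly_Mapping.keys x \<subseteq> S},
     monoid.mult = (\<lambda>x y. \<Sum>p\<in>Poly_Mapping.keys x. \<Sum>q\<in>Poly_Mapping.keys y.
        Poly_Mapping.single (f p q) (Poly_Mapping.lookup x p * Poly_Mapping.lookup y q)),
     one = Poly_Mapping.single e 1,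
     ring.zero = 0,
     add = (+),
     smult = (\<lambda>c. Poly_Mapping.map ((*) c))\<rparr>"

text \<open>The generated ideal is described inductively, rather than by \<^const>\<open>genideal\<close>, which would
  be the whole type if \<open>A\<close> were not a ring.\<close>

inductive_set two_sided_ideal :: "('c, 'a) module \<Rightarrow> 'a set \<Rightarrow> 'a set"
  for A :: "('c, 'a) module" and S :: "'a set" where
  base: "x \<in> S \<Longrightarrow> x \<in> two_sided_ideal A S"
| zero: "\<zero>\<^bsub>A\<^esub> \<in> two_sided_ideal A S"
| add: "\<lbrakk>x \<in> two_sided_ideal A S; y \<in> two_sided_ideal A S\<rbrakk> \<Longrightarrow> x \<oplus>\<^bsub>A\<^esub> y \<in> two_sided_ideal A S"
| smult: "x \<in> two_sided_ideal A S \<Longrightarrow> c \<odot>\<^bsub>A\<^esub> x \<in> two_sided_ideal A S"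
| left: "\<lbrakk>x \<in> two_sided_ideal A S; r \<in> carrier A\<rbrakk> \<Longrightarrow> r \<otimes>\<^bsub>A\<^esub> x \<in> two_sided_ideal A S"
| right: "\<lbrakk>x \<in> two_sided_ideal A S; r \<in> carrier A\<rbrakk> \<Longrightarrow> x \<otimes>\<^bsub>A\<^esub> r \<in> two_sided_ideal A S"

definition quot_alg :: "('c, 'a) module \<Rightarrow> 'a set \<Rightarrow> ('c, 'a set) module" where
  "quot_alg A J =
    \<lparr>carrier = carrier (A Quot J),
     monoid.mult = (\<lambda>X Y. X \<otimes>\<^bsub>A Quot J\<^esub> Y),
     one = \<one>\<^bsub>A Quot J\<^esub>,
     ring.zero = \<zero>\<^bsub>A Quot J\<^esub>,
     add = (\<lambda>X Y. X \<oplus>\<^bsub>A Quot J\<^esub> Y),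
     smult = (\<lambda>c X. \<Union>x\<in>X. J +>\<^bsub>A\<^esub> (c \<odot>\<^bsub>A\<^esub> x))\<rparr>"

inductive_set subalgebra_gen :: "('c, 'a) module \<Rightarrow> 'a set \<Rightarrow> 'a set"
  for A :: "('c, 'a) module" and S :: "'a set" where
  base: "x \<in> S \<Longrightarrow> x \<in> subalgebra_gen A S"
| zero: "\<zero>\<^bsub>A\<^esub> \<in> subalgebra_gen A S"
| one: "\<one>\<^bsub>A\<^esub> \<in> subalgebra_gen A S"
| add: "\<lbrakk>x \<in> subalgebra_gen A S; y \<in> subalgebra_gen A S\<rbrakk> \<Longrightarrow> x \<oplus>\<^bsub>A\<^esub> y \<in> subalgebra_gen A S"
| smult: "x \<in> subalgebra_gen A S \<Longrightarrow> c \<odot>\<^bsub>A\<^esub> x \<in> subalgebra_gen A S"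
| mult: "\<lbrakk>x \<in> subalgebra_gen A S; y \<in> subalgebra_gen A S\<rbrakk> \<Longrightarrow> x \<otimes>\<^bsub>A\<^esub> y \<in> subalgebra_gen A S"

definition alg_hom :: "('c, 'a) module \<Rightarrow> ('c, 'b) module \<Rightarrow> ('a \<Rightarrow> 'b) set" where
  "alg_hom A B = {h \<in> ring_hom A B. \<forall>c. \<forall>x\<in>carrier A. h (c \<odot>\<^bsub>A\<^esub> x) = c \<odot>\<^bsub>B\<^esub> h x}"


section \<open>The Temperley-Lieb algebra\<close>

definition free_TL :: "nat \<Rightarrow> (int poly, nat list \<Rightarrow>\<^sub>0 int poly) module" where
  "free_TL n = free_alg (lists {1..n + 1}) (@) []"

definition TL_rels :: "nat \<Rightarrow> (nat list \<Rightarrow>\<^sub>0 int poly) set" where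
  "TL_rels n =
     {Poly_Mapping.single [i, i] 1 - Poly_Mapping.single [i] delta | i. i \<in> {1..n + 1}}
   \<union> {Poly_Mapping.single [i, j] 1 - Poly_Mapping.single [j, i] 1 | i j.
        i \<in> {1..n + 1} \<and> j \<in> {1..n + 1} \<and> \<bar>int i - int j\<bar> > 1}
   \<union> {Poly_Mapping.single [i, j, i] 1 - Poly_Mapping.single [i] 1 | i j.
        i \<in> {2..n} \<and> j \<in> {2..n} \<and> \<bar>int i - int j\<bar> = 1}
   \<union> {Poly_Mapping.single [i, j, i, j] 1 - Poly_Mapping.single [i, j] 2 | i j.
        {i, j} = {1, 2} \<or> {i, j} = {n, n + 1}}"

definition TL_ideal :: "nat \<Rightarrow> (nat list \<Rightarrow>\<^sub>0 int poly) set" where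
  "TL_ideal n = two_sided_ideal (free_TL n) (TL_rels n)"

definition TL :: "nat \<Rightarrow> (int poly, (nat list \<Rightarrow>\<^sub>0 int poly) set) module" where
  "TL n = quot_alg (free_TL n) (TL_ideal n)"

definition b_gen :: "nat \<Rightarrow> nat \<Rightarrow> (nat list \<Rightarrow>\<^sub>0 int poly) set" where
  "b_gen n i = TL_ideal n +>\<^bsub>free_TL n\<^esub> Poly_Mapping.single [i] 1"

text \<open>For fully commutative \<open>w\<close>, any reduced expression gives the same product.\<close>

definition b_elt :: "nat \<Rightarrow> nat list set \<Rightarrow> (nat list \<Rightarrow>\<^sub>0 int poly) set" where
  "b_elt n w = foldr (\<lambda>i x. b_gen n i \<otimes>\<^bsub>TL n\<^esub> x) (reduced_expr w) \<one>\<^bsub>TL n\<^esub>"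


section \<open>Decorated diagrams\<close>

datatype deco = Bdot | Btri | Wdot | Wtri

definition black :: "deco \<Rightarrow> bool" where
  "black c \<longleftrightarrow> c = Bdot \<or> c = Btri"

datatype node = North nat | South nat

text \<open>Combinatorial data of an isotopy class of decorated pseudo diagrams.

  \<^item> \<open>arcs\<close> contains every edge twice, once for each direction, with the word on the edge as it is
    read in that direction.
  \<^item> \<open>vert\<close> is used only if there is exactly one non-propagating edge on the north face: it lists
    the decorations on the propagating edges from north to south, each tagged with the north node
    of its edge.  The blocks are the maximal runs of equal tags; so no decoration on another edge
    lies in the vertical range of a block, and adjacent blocks are conjoined whenever possible.
    Decorations on non-propagating edges do not occur in \<open>vert\<close>, their vertical position being
    forced.
  \<^item> \<open>loops\<close> records each loop by the cyclic word read clockwise along it.  The region in which a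
    loop lies is not recorded: it is irrelevant for an undecorated loop, which is removed with a
    factor \<open>\<delta>\<close>, and a decorated loop must lie in the region of the wall (or walls) to which its
    decorations can be taken.\<close>

record ddiag =
  arcs :: "(node \<times> deco list \<times> node) set"
  vert :: "(nat \<times> deco) list"
  loops :: "deco list set multiset"

definition cyc :: "deco list \<Rightarrow> deco list set" where
  "cyc w = {rotate k w | k. True}"

definition beads :: "nat \<Rightarrow> (nat \<times> deco) list \<Rightarrow> deco list" where
  "beads i vs = map snd (filter (\<lambda>b. fst b = i) vs)"

definition props :: "ddiag \<Rightarrow> nat set" where
  "props D = {i. \<exists>w j. (North i, w, South j) \<in> arcs D}"

definition a_val :: "ddiag \<Rightarrow> nat" where
  "a_val D = card {(i, j). i < j \<and> (\<exists>w. (North i, w, North j) \<in> arcs D)}"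

fun propagating :: "node \<Rightarrow> node \<Rightarrow> bool" where
  "propagating (North i) (South j) = True"
| "propagating (South i) (North j) = True"
| "propagating (North i) (North j) = False"
| "propagating (South i) (South j) = False"

definition nodes :: "nat \<Rightarrow> node set" where
  "nodes n = North ` {1..n + 2} \<union> South ` {1..n + 2}"

text \<open>The positions of the nodes on the boundary of the box, which is cut open at the left wall
  and at the right wall respectively.  An edge borders the region of the left (right) wall iff it is
  not nested inside another edge in the corresponding linear order.\<close>

fun lpos :: "nat \<Rightarrow> node \<Rightarrow> nat" where
  "lpos n (North i) = i"
| "lpos n (South i) = 2 * (n + 2) + 1 - i"

fun rpos :: "nat \<Rightarrow> node \<Rightarrow> nat" where
  "rpos n (South i) = n + 3 - i"
| "rpos n (North i) = n + 2 + i"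

definition outermost :: "(node \<Rightarrow> nat) \<Rightarrow> ddiag \<Rightarrow> node \<Rightarrow> node \<Rightarrow> bool" where
  "outermost pos D x y \<longleftrightarrow> \<not> (\<exists>x' w' y'. (x', w', y') \<in> arcs D \<and>
     pos x' < pos x \<and> pos x' < pos y \<and> pos x < pos y' \<and> pos y < pos y')"

definition matching :: "nat \<Rightarrow> ddiag \<Rightarrow> bool" where
  "matching n D \<longleftrightarrow>
     arcs D \<subseteq> nodes n \<times> UNIV \<times> nodes n
   \<and> (\<forall>x\<in>nodes n. \<exists>!e. (x, e) \<in> arcs D)
   \<and> (\<forall>x w y. (x, w, y) \<in> arcs D \<longrightarrow> x \<noteq> y \<and> (y, rev w, x) \<in> arcs D)
   \<and> \<not> (\<exists>x w y x' w' y'. (x, w, y) \<in> arcs D \<and> (x', w', y') \<in> arcs D \<and>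
          lpos n x < lpos n x' \<and> lpos n x' < lpos n y \<and> lpos n y < lpos n y')"

definition black_first :: "deco list \<Rightarrow> bool" where
  "black_first w \<longleftrightarrow> sorted_wrt (\<lambda>c e. black e \<longrightarrow> black c) w"

text \<open>The black decorations can be taken to the left wall and the white ones to the right wall
  simultaneously: every decorated edge borders the region of the wall in question, and along
  each face (and clockwise around each loop, from a suitable starting point) no white
  decoration comes before a black one.  If some edge is propagating, then the regions of the two
  walls are different, so a loop cannot carry both colours.\<close>

definition deformable :: "nat \<Rightarrow> ddiag \<Rightarrow> bool" where
  "deformable n D \<longleftrightarrow>
     (\<forall>x w y. (x, w, y) \<in> arcs D \<longrightarrow>
        ((\<exists>c\<in>set w. black c) \<longrightarrow> outermost (lpos n) D x y) \<and>
        ((\<exists>c\<in>set w. \<not> black c) \<longrightarrow> outermost (rpos n) D x y))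
   \<and> (\<forall>F\<in>{North, South}.
        (\<forall>i w j. (F i, w, F j) \<in> arcs D \<and> i < j \<longrightarrow> black_first w) \<and>
        (\<forall>i w j i' w' j'. (F i, w, F j) \<in> arcs D \<and> (F i', w', F j') \<in> arcs D \<and>
           i < j \<and> j < i' \<and> i' < j' \<longrightarrow> black_first (w @ w')))
   \<and> (\<forall>L\<in>#loops D. \<exists>u. L = cyc u \<and> black_first u \<and>
        ((\<exists>c\<in>set u. black c) \<and> (\<exists>c\<in>set u. \<not> black c) \<longrightarrow> props D = {}))"

definition ddiagrams :: "nat \<Rightarrow> ddiag set" where
  "ddiagrams n = {D. matching n D \<and> deformable n D
     \<and> (a_val D = 0 \<longrightarrow> (\<forall>x w y. (x, w, y) \<in> arcs D \<longrightarrow> w = []) \<and> (\<forall>L\<in>#loops D. L = cyc []))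
     \<and> (if a_val D = 1
        then fst ` set (vert D) \<subseteq> props D \<and>
             (\<forall>i w j. (North i, w, South j) \<in> arcs D \<longrightarrow> w = beads i (vert D))
        else vert D = [])}"


subsection \<open>Concatenation\<close>

datatype point = Top nat | Mid nat | Bot nat

fun upper :: "node \<Rightarrow> point" where
  "upper (North i) = Top i"
| "upper (South i) = Mid i"

fun lower :: "node \<Rightarrow> point" where
  "lower (North i) = Mid i"
| "lower (South i) = Bot i"

fun outer :: "node \<Rightarrow> point" where
  "outer (North i) = Top i"
| "outer (South i) = Bot i"

definition steps :: "ddiag \<Rightarrow> ddiag \<Rightarrow> bool \<Rightarrow> (point \<times> deco list \<times> point) set" where
  "steps D' D up = (if up then (\<lambda>(x, w, y). (upper x, w, upper y)) ` arcs D'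
                    else (\<lambda>(x, w, y). (lower x, w, lower y)) ` arcs D)"

text \<open>\<open>walk D' D up p w ks q\<close>: with \<open>D'\<close> on top of \<open>D\<close>, one gets from \<open>p\<close> to \<open>q\<close> by running
  alternately through edges of \<open>D'\<close> and of \<open>D\<close>, reading \<open>w\<close> and visiting the middle nodes \<open>ks\<close> in
  between; the first edge belongs to \<open>D'\<close> iff \<open>up\<close>.\<close>

inductive walk ::
  "ddiag \<Rightarrow> ddiag \<Rightarrow> bool \<Rightarrow> point \<Rightarrow> deco list \<Rightarrow> nat list \<Rightarrow> point \<Rightarrow> bool"
  for D' D where
  single: "(p, w, q) \<in> steps D' D up \<Longrightarrow> walk D' D up p w [] q"
| cons: "\<lbrakk>(p, u, Mid k) \<in> steps D' D up; walk D' D (\<not> up) (Mid k) v ks q\<rbrakk>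
      \<Longrightarrow> walk D' D up p (u @ v) (k # ks) q"

definition conc_arcs :: "ddiag \<Rightarrow> ddiag \<Rightarrow> (node \<times> deco list \<times> node) set" where
  "conc_arcs D' D = {(x, w, y). \<exists>up ks. walk D' D up (outer x) w ks (outer y)}"

text \<open>A loop created in the middle, starting at its leftmost middle node \<open>k\<close>; starting upwards
  there amounts to running clockwise.\<close>

definition mid_loop :: "ddiag \<Rightarrow> ddiag \<Rightarrow> nat \<Rightarrow> deco list \<Rightarrow> bool" where
  "mid_loop D' D k w \<longleftrightarrow>
     (\<exists>ks. walk D' D True (Mid k) w ks (Mid k) \<and> distinct ks \<and> (\<forall>j\<in>set ks. k < j))"

definition conc_loops :: "ddiag \<Rightarrow> ddiag \<Rightarrow> deco list set multiset" where
  "conc_loops D' D = loops D' + loops D +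
     image_mset (\<lambda>k. cyc (THE w. mid_loop D' D k w)) (mset_set {k. \<exists>w. mid_loop D' D k w})"

text \<open>If the product has one non-propagating edge on the north face, then from north to south one
  meets the decorations on propagating edges of \<open>D'\<close>, those on the non-propagating edges of
  \<open>D'\<close> and \<open>D\<close> in the middle that have become parts of propagating edges, and those on
  propagating edges of \<open>D\<close>.  In the middle, at most one propagating edge receives decorations, so
  the order of the edges in that part does not matter.\<close>

definition mid_word :: "ddiag \<Rightarrow> ddiag \<Rightarrow> nat \<Rightarrow> deco list" where
  "mid_word D' D i = (THE m. \<exists>u k l v j. (North i, u, South k) \<in> arcs D' \<and>
     (North l, v, South j) \<in> arcs D \<and> (North i, u @ m @ v, South j) \<in> conc_arcs D' D)"

definition retag :: "ddiag \<Rightarrow> ddiag \<Rightarrow> nat \<Rightarrow> nat" where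
  "retag D' D l = (THE i. \<exists>v w j. (North l, v, South j) \<in> arcs D \<and>
     (North i, w, South j) \<in> conc_arcs D' D)"

definition conc_vert :: "ddiag \<Rightarrow> ddiag \<Rightarrow> (nat \<times> deco) list" where
  "conc_vert D' D = vert D'
     @ concat (map (\<lambda>i. map (Pair i) (mid_word D' D i))
         (sorted_list_of_set {i. \<exists>w j. (North i, w, South j) \<in> conc_arcs D' D}))
     @ map (map_prod (retag D' D) id) (vert D)"

definition conc :: "ddiag \<Rightarrow> ddiag \<Rightarrow> ddiag" where
  "conc D' D =
     (let E = \<lparr>arcs = conc_arcs D' D, vert = [], loops = conc_loops D' D\<rparr>
      in if a_val E = 1 then E\<lparr>vert := conc_vert D' D\<rparr> else E)"

definition id_diag :: "nat \<Rightarrow> ddiag" where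
  "id_diag n = \<lparr>arcs = (\<Union>j\<in>{1..n + 2}. {(North j, [], South j), (South j, [], North j)}),
     vert = [], loops = {#}\<rparr>"

text \<open>The simple diagram with the word \<open>w\<close> on both non-propagating edges; \<open>w\<close> has at most one
  letter.\<close>

definition simple_diag :: "nat \<Rightarrow> nat \<Rightarrow> deco list \<Rightarrow> ddiag" where
  "simple_diag n i w =
     \<lparr>arcs = {(North i, w, North (i + 1)), (North (i + 1), w, North i),
              (South i, w, South (i + 1)), (South (i + 1), w, South i)}
        \<union> (\<Union>j\<in>{1..n + 2} - {i, i + 1}. {(North j, [], South j), (South j, [], North j)}),
      vert = [], loops = {#}\<rparr>"


subsection \<open>The diagram algebra\<close>

inductive deco_rel :: "deco list \<Rightarrow> int poly \<Rightarrow> deco list \<Rightarrow> bool" where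
  "deco_rel [Bdot, Bdot] 1 [Btri]"
| "deco_rel [Bdot, Btri] 2 [Bdot]"
| "deco_rel [Btri, Bdot] 2 [Bdot]"
| "deco_rel [Wdot, Wdot] 1 [Wtri]"
| "deco_rel [Wdot, Wtri] 2 [Wdot]"
| "deco_rel [Wtri, Wdot] 2 [Wdot]"

definition replace_word :: "node \<Rightarrow> deco list \<Rightarrow> node \<Rightarrow> ddiag \<Rightarrow> ddiag" where
  "replace_word x w y D = D\<lparr>arcs := (\<lambda>(p, u, q).
     (p, if p = x \<and> q = y then w else if p = y \<and> q = x then rev w else u, q)) ` arcs D\<rparr>"

text \<open>\<open>diag_rel D c D'\<close>: the relation \<open>D = c D'\<close> is imposed.\<close>

inductive diag_rel :: "ddiag \<Rightarrow> int poly \<Rightarrow> ddiag \<Rightarrow> bool" where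
  edge: "\<lbrakk>deco_rel p c r; (x, u @ p @ v, y) \<in> arcs D; a_val D \<noteq> 1 \<or> \<not> propagating x y\<rbrakk>
      \<Longrightarrow> diag_rel D c (replace_word x (u @ r @ v) y D)"
| block: "\<lbrakk>deco_rel p c r; a_val D = 1; vert D = us @ map (Pair i) p @ vs;
       vert' = us @ map (Pair i) r @ vs; (North i, w, South j) \<in> arcs D\<rbrakk>
      \<Longrightarrow> diag_rel D c ((replace_word (North i) (beads i vert') (South j) D)\<lparr>vert := vert'\<rparr>)"
| loop: "\<lbrakk>deco_rel p c r; loops D = add_mset (cyc (p @ v)) M\<rbrakk>
      \<Longrightarrow> diag_rel D c (D\<lparr>loops := add_mset (cyc (r @ v)) M\<rparr>)"
| loop_delta: "\<lbrakk>w \<in> {[], [Btri], [Wtri]}; loops D = add_mset (cyc w) M\<rbrakk>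
      \<Longrightarrow> diag_rel D delta (D\<lparr>loops := M\<rparr>)"

definition free_diag_alg :: "nat \<Rightarrow> (int poly, ddiag \<Rightarrow>\<^sub>0 int poly) module" where
  "free_diag_alg n = free_alg (ddiagrams n) conc (id_diag n)"

definition diag_ideal :: "nat \<Rightarrow> (ddiag \<Rightarrow>\<^sub>0 int poly) set" where
  "diag_ideal n = two_sided_ideal (free_diag_alg n)
     {Poly_Mapping.single D 1 - Poly_Mapping.single D' c | D c D'.
        D \<in> ddiagrams n \<and> D' \<in> ddiagrams n \<and> diag_rel D c D'}"

definition diag_alg :: "nat \<Rightarrow> (int poly, (ddiag \<Rightarrow>\<^sub>0 int poly) set) module" where
  "diag_alg n = quot_alg (free_diag_alg n) (diag_ideal n)"

definition diag_class :: "nat \<Rightarrow> ddiag \<Rightarrow> (ddiag \<Rightarrow>\<^sub>0 int poly) set" where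
  "diag_class n D = diag_ideal n +>\<^bsub>free_diag_alg n\<^esub> Poly_Mapping.single D 1"

definition d_gen :: "nat \<Rightarrow> nat \<Rightarrow> (ddiag \<Rightarrow>\<^sub>0 int poly) set" where
  "d_gen n i = diag_class n
     (simple_diag n i (if i = 1 then [Bdot] else if i = n + 1 then [Wdot] else []))"

definition DC :: "nat \<Rightarrow> (int poly, (ddiag \<Rightarrow>\<^sub>0 int poly) set) module" where
  "DC n = (diag_alg n)\<lparr>carrier := subalgebra_gen (diag_alg n) (d_gen n ` {1..n + 1})\<rparr>"

text \<open>As the \<open>b_gen n i\<close> generate \<open>TL n\<close>, a morphism with these values is unique on the
  carrier.\<close>

definition is_theta ::
  "nat \<Rightarrow> ((nat list \<Rightarrow>\<^sub>0 int poly) set \<Rightarrow> (ddiag \<Rightarrow>\<^sub>0 int poly) set) \<Rightarrow> bool" where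
  "is_theta n \<theta> \<longleftrightarrow> \<theta> \<in> alg_hom (TL n) (DC n) \<and> (\<forall>i\<in>{1..n + 1}. \<theta> (b_gen n i) = d_gen n i)"


section \<open>The map \<open>\<tau>\<close> and the decoration of zigzags\<close>

definition diag_prod :: "nat \<Rightarrow> nat list \<Rightarrow> ddiag" where
  "diag_prod n a = foldr (\<lambda>i D. conc (simple_diag n i []) D) a (id_diag n)"

definition d_elt :: "nat \<Rightarrow> nat list set \<Rightarrow> ddiag" where
  "d_elt n u = diag_prod n (reduced_expr u)"

text \<open>The product of undecorated diagrams equals \<open>\<delta>\<^sup>\<alpha>\<close> times a loop-free diagram iff it consists
  of that diagram and \<open>\<alpha>\<close> loops.\<close>

definition tau :: "nat \<Rightarrow> nat list set \<Rightarrow> nat list set" where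
  "tau n w = (SOME u. u \<in> FC_A n \<and> (\<exists>\<alpha>. diag_prod n (reduced_expr w)
     = (d_elt n u)\<lparr>loops := replicate_mset \<alpha> (cyc [])\<rparr>))"

primrec replace_first :: "'a \<Rightarrow> 'a \<Rightarrow> 'a list \<Rightarrow> 'a list" where
  "replace_first x y [] = []"
| "replace_first x y (z # zs) = (if z = x then y # zs else z # replace_first x y zs)"

definition replace_last :: "'a \<Rightarrow> 'a \<Rightarrow> 'a list \<Rightarrow> 'a list" where
  "replace_last x y zs = rev (replace_first x y (rev zs))"

text \<open>The nodes of the heap labelled by the first or the last generator form a chain; they
  are listed from top to bottom.\<close>

definition end_nodes :: "nat \<Rightarrow> nat list \<Rightarrow> nat list" where
  "end_nodes n a = (THE ps. set ps = {p. p < length a \<and> (a ! p = 1 \<or> a ! p = n + 1)} \<and>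
     sorted_wrt (heap_less (mC n) a) ps)"

definition decZ_vert :: "nat \<Rightarrow> nat list \<Rightarrow> nat \<Rightarrow> nat \<Rightarrow> (nat \<times> deco) list" where
  "decZ_vert n a f l =
     (let v0 = map (\<lambda>p. if a ! p = 1 then (f, Btri) else (l, Wtri)) (end_nodes n a);
          v1 = (if hd a = 1 then replace_first (f, Btri) (f, Bdot) v0
                else if hd a = n + 1 then replace_first (l, Wtri) (l, Wdot) v0 else v0)
      in if last a = 1 then replace_last (f, Btri) (f, Bdot) v1
         else if last a = n + 1 then replace_last (l, Wtri) (l, Wdot) v1 else v1)"

text \<open>The word on the non-propagating edge \<open>{i, j}\<close> of a face, for the letter \<open>s\<close> of the
  expression at that face.\<close>

definition decZ_cup :: "nat \<Rightarrow> nat \<Rightarrow> nat \<Rightarrow> nat \<Rightarrow> deco list" where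
  "decZ_cup n s i j =
     (if s = 1 \<and> {i, j} = {1, 2} then [Bdot]
      else if s = n + 1 \<and> {i, j} = {n + 1, n + 2} then [Wdot] else [])"

fun decZ_word :: "nat \<Rightarrow> nat list \<Rightarrow> (nat \<times> deco) list \<Rightarrow> node \<Rightarrow> node \<Rightarrow> deco list" where
  "decZ_word n a vs (North i) (North j) = decZ_cup n (hd a) i j"
| "decZ_word n a vs (South i) (South j) = decZ_cup n (last a) i j"
| "decZ_word n a vs (North i) (South j) = beads i vs"
| "decZ_word n a vs (South j) (North i) = rev (beads i vs)"

definition decZ :: "nat \<Rightarrow> nat list set \<Rightarrow> ddiag" where
  "decZ n w =
     (let a = zigzag_expr n w;
          D = d_elt n (tau n w);
          vs = decZ_vert n a (Min (props D)) (Max (props D))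
      in D\<lparr>arcs := (\<lambda>(x, u, y). (x, decZ_word n a vs x y, y)) ` arcs D, vert := vs\<rparr>)"

end

theory Submission
  imports Defs "HOL-Combinatorics.Transposition"
begin

text \<open>
  Consecutive letters of a zigzag word differ by one, so no commutation applies and the word is the
  only reduced expression of its element.  Multiplying the generators from right to left,
  every partial product is a diagram with one cup and one cap (up to the relations), and a further
  letter \<open>i\<close> in front of a word starting with \<open>j = i \<plusminus> 1\<close> moves the cup from \<open>j\<close> to \<open>i\<close>.  The
  decorations on the old cup and on the cap of the new factor end up on top of the propagating edge
  that is straightened.  Hence an inner letter \<open>1\<close> first contributes the \<open>\<bullet>\<close> of its cap and, one
  step later, the \<open>\<bullet>\<close> of its cup, which merge into one \<open>\<bullet>\<bullet> = \<triangle>\<close>; the first and the last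
  letter contribute only one of the two to a propagating edge.
\<close>

section \<open>Diagrams with one cup and one cap\<close>

text \<open>Black decorations on propagating edges always lie on the leftmost such edge and white
  ones on the rightmost, so the colour determines the edge. A diagram met while letters are added is
  therefore given by the positions of its cup and cap and one list of decorations, and moving the
  cup only re-tags that list. Two points go beyond computation. The element \<open>tau n w\<close>
  is an arbitrary choice, and the equation that it satisfies overwrites the loops of its diagram. So
  besides a witness (the monotone word from the first to the last letter, shortest in its class
  because of its action as a permutation), one has to exclude loops from the diagram of whatever
  element is chosen. Moreover, \<open>conc\<close> is not shown to be associative or to preserve
  \<open>ddiagrams n\<close>, so products of classes of diagrams are computed without a ring
  structure, and the existence of \<theta> supplies the missing closure property.\<close>

definition skip :: "nat \<Rightarrow> nat \<Rightarrow> nat" where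
  "skip p t = (if t < p then t else t + 2)"

definition unskip :: "nat \<Rightarrow> nat \<Rightarrow> nat" where
  "unskip p k = (if k < p then k else k - 2)"

text \<open>The nodes left over by the cup and the cap have to be joined in increasing order, since
  other propagating edges would cross. Hence node \<open>k\<close> is renumbered past the cup and
  then spread out around the cap.\<close>

fun link :: "nat \<Rightarrow> nat \<Rightarrow> node \<Rightarrow> node" where
  "link p r (North k) = (if k = p then North (p + 1) else if k = p + 1 then North p
     else South (skip r (unskip p k)))"
| "link p r (South k) = (if k = r then South (r + 1) else if k = r + 1 then South r
     else North (skip p (unskip r k)))"

fun link_word ::
  "nat \<Rightarrow> nat \<Rightarrow> deco list \<Rightarrow> deco list \<Rightarrow> (nat \<times> deco) list \<Rightarrow> node \<Rightarrow> deco list" where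
  "link_word p r u v vs (North k) = (if k = p then u else if k = p + 1 then rev u else beads k vs)"
| "link_word p r u v vs (South k) = (if k = r then v else if k = r + 1 then rev v
     else rev (beads (skip p (unskip r k)) vs))"

text \<open>As the graph of a function on the nodes, so that an arc is decided by its starting node;
  both directions of an edge occur because \<open>link\<close> is an involution that reverses
  words.\<close>

definition one_cup ::
  "nat \<Rightarrow> nat \<Rightarrow> nat \<Rightarrow> deco list \<Rightarrow> deco list \<Rightarrow> (nat \<times> deco) list \<Rightarrow> ddiag" where
  "one_cup n p r u v vs =
     \<lparr>arcs = (\<lambda>x. (x, link_word p r u v vs x, link p r x)) ` nodes n, vert = vs, loops = {#}\<rparr>"

lemma North_in_nodes [simp]: "North k \<in> nodes n \<longleftrightarrow> 1 \<le> k \<and> k \<le> n + 2"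
  and South_in_nodes [simp]: "South k \<in> nodes n \<longleftrightarrow> 1 \<le> k \<and> k \<le> n + 2"
  by (auto simp: nodes_def)

lemma one_cup_simps [simp]:
  "vert (one_cup n p r u v vs) = vs"
  "loops (one_cup n p r u v vs) = {#}"
  by (simp_all add: one_cup_def)

lemma arcs_one_cup:
  "(x, w, y) \<in> arcs (one_cup n p r u v vs) \<longleftrightarrow>
     x \<in> nodes n \<and> w = link_word p r u v vs x \<and> y = link p r x"
  by (auto simp: one_cup_def)

lemma link_in_nodes:
  assumes "x \<in> nodes n" "p \<in> {1..n + 1}" "r \<in> {1..n + 1}"
  shows "link p r x \<in> nodes n"
  using assms by (cases x) (auto simp: skip_def unskip_def)

lemma skip_unskip: "k \<noteq> p \<Longrightarrow> k \<noteq> p + 1 \<Longrightarrow> skip p (unskip p k) = k"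
  by (auto simp: skip_def unskip_def)

lemma unskip_skip: "unskip p (skip p t) = t"
  by (auto simp: skip_def unskip_def)

lemma skip_neq [simp]: "skip p t \<noteq> p" "skip p t \<noteq> Suc p"
  by (auto simp: skip_def)

lemma skip_unskip_mono:
  assumes "a < b" "a \<noteq> p" "a \<noteq> p + 1" "b \<noteq> p" "b \<noteq> p + 1"
  shows "skip r (unskip p a) < skip r (unskip p b)"
proof -
  have "unskip p a < unskip p b" using assms by (auto simp: unskip_def)
  then show ?thesis by (auto simp: skip_def)
qed

lemma link_link: "link p r (link p r x) = x"
  by (cases x) (auto simp: skip_unskip unskip_skip)

lemma link_neq: "link p r x \<noteq> x"
  by (cases x) auto

lemma link_word_link: "link_word p r u v vs (link p r x) = rev (link_word p r u v vs x)"
  by (cases x) (auto simp: skip_unskip unskip_skip)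

text \<open>The cup and the cap join neighbouring positions, and the propagating edges are nested
  because \<open>skip r (unskip p k)\<close> increases with \<open>k\<close> while
  \<open>lpos\<close> decreases along the south face.\<close>

lemma link_noncrossing:
  assumes "x \<in> nodes n" "x' \<in> nodes n" "p \<in> {1..n + 1}" "r \<in> {1..n + 1}"
  shows "\<not> (lpos n x < lpos n x' \<and> lpos n x' < lpos n (link p r x)
     \<and> lpos n (link p r x) < lpos n (link p r x'))"
proof
  assume *: "lpos n x < lpos n x' \<and> lpos n x' < lpos n (link p r x)
     \<and> lpos n (link p r x) < lpos n (link p r x')"
  note range = link_in_nodes[OF assms(1,3,4)] link_in_nodes[OF assms(2,3,4)]
  show False
  proof (cases x)
    case (North a)
    then have a: "a \<noteq> p" "a \<noteq> p + 1" using * by (auto split: if_splits)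
    then have link: "link p r x = South (skip r (unskip p a))" using North by simp
    show False
    proof (cases x')
      case x': (North b)
      then have b: "b \<noteq> p" "b \<noteq> p + 1"
        using * link assms(3) range by auto
      then have "skip r (unskip p a) < skip r (unskip p b)"
        using a * North x' by (intro skip_unskip_mono) auto
      then show False using * link b x' range by auto
    next
      case (South b)
      then show False using * link assms range by (auto split: if_splits)
    qed
  next
    case (South a)
    \<comment> \<open>\<open>lpos\<close> runs from right to left on the south face, so the right
      end of the cap is the only south node that precedes its partner.\<close>
    then have "a = r + 1" using * assms range by (auto split: if_splits)
    then show False using South * assms(2,4) by (cases x') auto
  qed
qed

lemma matching_one_cup:
  assumes "p \<in> {1..n + 1}" "r \<in> {1..n + 1}"
  shows "matching n (one_cup n p r u v vs)"
  unfolding matching_def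
proof (intro conjI)
  show "arcs (one_cup n p r u v vs) \<subseteq> nodes n \<times> UNIV \<times> nodes n"
    using link_in_nodes[OF _ assms] by (auto simp: arcs_one_cup)
  show "\<forall>x\<in>nodes n. \<exists>!e. (x, e) \<in> arcs (one_cup n p r u v vs)"
    by (auto simp: one_cup_def)
  show "\<forall>x w y. (x, w, y) \<in> arcs (one_cup n p r u v vs)
      \<longrightarrow> x \<noteq> y \<and> (y, rev w, x) \<in> arcs (one_cup n p r u v vs)"
    using link_in_nodes[OF _ assms] link_neq
    by (auto simp: arcs_one_cup link_link link_word_link) metis
qed (use link_noncrossing[OF _ _ assms] in \<open>fastforce simp: arcs_one_cup\<close>)

lemma props_one_cup: "props (one_cup n p r u v vs) = {1..n + 2} - {p, p + 1}"
  by (auto simp: props_def arcs_one_cup)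

lemma a_val_one_cup:
  assumes "p \<in> {1..n + 1}"
  shows "a_val (one_cup n p r u v vs) = 1"
proof -
  have "{(i, j). i < j \<and> (\<exists>w. (North i, w, North j) \<in> arcs (one_cup n p r u v vs))} = {(p, p + 1)}"
    using assms by (auto simp: arcs_one_cup split: if_splits)
  then show ?thesis by (simp add: a_val_def)
qed

text \<open>The value of \<open>Min (props D)\<close> for a cup at \<open>p\<close>; likewise
  \<open>last_prop\<close> is the maximum. Both use that n \<ge> 2 leaves a node beside the
  cup.\<close>

definition first_prop :: "nat \<Rightarrow> nat" where
  "first_prop p = (if p = 1 then 3 else 1)"

definition last_prop :: "nat \<Rightarrow> nat \<Rightarrow> nat" where
  "last_prop n p = (if p = n + 1 then n else n + 2)"

text \<open>Tags are a function of the colour and the cup, so the decorations can be carried along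
  as a list without edges and tagged anew after each move of the cup.\<close>

definition tag :: "nat \<Rightarrow> nat \<Rightarrow> deco \<Rightarrow> nat \<times> deco" where
  "tag n p c = (if black c then first_prop p else last_prop n p, c)"

lemma fst_tag:
  assumes "n \<ge> 2" "p \<in> {1..n + 1}"
  shows "fst (tag n p c) \<in> {1..n + 2} - {p, p + 1}"
  using assms by (simp add: tag_def first_prop_def last_prop_def)

lemma black_simps [simp]: "black Bdot" "black Btri" "\<not> black Wdot" "\<not> black Wtri"
  by (auto simp: black_def)

definition dot :: "nat \<Rightarrow> nat \<Rightarrow> deco list" where
  "dot n i = (if i = 1 then [Bdot] else if i = n + 1 then [Wdot] else [])"

lemma rev_dot [simp]: "rev (dot n i) = dot n i"
  by (simp add: dot_def)

lemma set_beads: "c \<in> set (beads k vs) \<longleftrightarrow> (k, c) \<in> set vs"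
  by (force simp: beads_def)

lemma black_beads_tag:
  assumes "c \<in> set (beads k (map (tag n p) ds))" "n \<ge> 2"
  shows "k = (if black c then first_prop p else last_prop n p)"
  using assms by (auto simp: set_beads tag_def split: if_splits)

lemma outermost_commute: "outermost pos D x y = outermost pos D y x"
  unfolding outermost_def by metis

lemma outermost_one_cupI:
  assumes "\<And>x'. x' \<in> nodes n \<Longrightarrow> pos x' < pos x \<Longrightarrow> pos x' < pos y \<Longrightarrow>
    pos x < pos (link p r x') \<Longrightarrow> pos y < pos (link p r x') \<Longrightarrow> False"
  shows "outermost pos (one_cup n p r u v vs) x y"
  unfolding outermost_def using assms by (auto simp: arcs_one_cup)

lemma lpos_range: "x \<in> nodes n \<Longrightarrow> 1 \<le> lpos n x \<and> lpos n x \<le> 2 * n + 4"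
  and rpos_range: "x \<in> nodes n \<Longrightarrow> 1 \<le> rpos n x \<and> rpos n x \<le> 2 * n + 4"
  by (cases x; auto)+

context
  fixes n p r :: nat
  assumes n: "n \<ge> 2" and p: "p \<in> {1..n + 1}" and r: "r \<in> {1..n + 1}"
begin

text \<open>An enclosing edge would need a position beyond the first or the last one.\<close>

lemma outermost_lpos_extreme:
  assumes "lpos n x = 1 \<or> lpos n x = 2 * n + 4"
  shows "outermost (lpos n) (one_cup n p r u v vs) x y"
  using lpos_range[of _ n] link_in_nodes[OF _ p r] assms
  by (intro outermost_one_cupI) (metis leD)

lemma outermost_rpos_extreme:
  assumes "rpos n x = 1 \<or> rpos n x = 2 * n + 4"
  shows "outermost (rpos n) (one_cup n p r u v vs) x y"
  using rpos_range[of _ n] link_in_nodes[OF _ p r] assms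
  by (intro outermost_one_cupI) (metis leD)

text \<open>If the cup occupies 1 and 2, it is the only edge that starts before node 3, and it also
  ends before it; otherwise node 1 is extreme.\<close>

lemma outermost_first_prop:
  "outermost (lpos n) (one_cup n p r u v vs) (North (first_prop p)) y"
proof (cases "p = 1")
  case True
  show ?thesis
  proof (rule outermost_one_cupI)
    fix x' assume "x' \<in> nodes n" "lpos n x' < lpos n (North (first_prop p))"
      "lpos n (North (first_prop p)) < lpos n (link p r x')"
    then show False using True n by (cases x') (auto simp: first_prop_def split: if_splits)
  qed
qed (use outermost_lpos_extreme[of "North 1"] in \<open>auto simp: first_prop_def\<close>)

lemma outermost_last_prop:
  "outermost (rpos n) (one_cup n p r u v vs) (North (last_prop n p)) y"
proof (cases "p = n + 1")
  case True
  show ?thesis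
  proof (rule outermost_one_cupI)
    fix x' assume x': "x' \<in> nodes n" "rpos n x' < rpos n (North (last_prop n p))"
      "rpos n (North (last_prop n p)) < rpos n (link p r x')"
    \<comment> \<open>It is easier to look at the far end: beyond position \<open>2 * n + 2\<close>
      there are only the two ends of the cup, which are joined to each other.\<close>
    define y' where "y' = link p r x'"
    have y': "x' = link p r y'" "y' \<in> nodes n"
      using link_in_nodes[OF x'(1) p r] by (simp_all add: y'_def link_link)
    have "rpos n (link p r y') < 2 * n + 2" "2 * n + 2 < rpos n y'"
      using x' True unfolding y'(1) link_link by (simp_all add: last_prop_def)
    then show False using True y'(2) by (cases y') (auto split: if_splits)
  qed
qed (use outermost_rpos_extreme[of "North (n + 2)"] in \<open>auto simp: last_prop_def\<close>)

lemma decorated_arc_cases: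
  assumes "c \<in> set (link_word p r (dot n p) (dot n r) (map (tag n p) ds) x)"
  obtains (cup) "{x, link p r x} = {North p, North (p + 1)}" "c \<in> set (dot n p)"
    | (cap) "{x, link p r x} = {South r, South (r + 1)}" "c \<in> set (dot n r)"
    | (through) y where "{x, link p r x} =
        {North (if black c then first_prop p else last_prop n p), y}"
proof (cases x)
  case (North k)
  show thesis
  proof (cases "k = p \<or> k = p + 1")
    case True
    with North assms show thesis by (intro cup) (auto split: if_splits)
  next
    case False
    with North assms have "c \<in> set (beads k (map (tag n p) ds))" by simp
    from black_beads_tag[OF this n] North show thesis by (intro through) auto
  qed
next
  case (South k)
  show thesis
  proof (cases "k = r \<or> k = r + 1")
    case True
    with South assms show thesis by (intro cap) (auto split: if_splits)
  next
    case False
    with South assms have "c \<in> set (beads (skip p (unskip r k)) (map (tag n p) ds))" by simp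
    from black_beads_tag[OF this n] South False show thesis by (intro through) auto
  qed
qed

lemma outermost_decorated:
  assumes c: "c \<in> set (link_word p r (dot n p) (dot n r) (map (tag n p) ds) x)"
  shows "outermost (if black c then lpos n else rpos n) (one_cup n p r u v vs) x (link p r x)"
    (is "?out x (link p r x)")
proof -
  have out: "?out x (link p r x)" if "{x, link p r x} = {y, z}" "?out y z" for y z
    using that outermost_commute by (metis doubleton_eq_iff)
  from c show ?thesis
  proof (cases rule: decorated_arc_cases)
    case cup
    then show ?thesis
      using outermost_lpos_extreme[of "North 1"]
        outermost_rpos_extreme[of "North (n + 2)"]
        outermost_commute[of "rpos n" _ "North (n + 1)"] n
      by (intro out[OF cup(1)]) (auto simp: dot_def split: if_splits)
  next
    case cap
    then show ?thesis
      using outermost_lpos_extreme[of "South 1"]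
        outermost_rpos_extreme[of "South (n + 2)"]
        outermost_commute[of "rpos n" _ "South (n + 1)"] n
      by (intro out[OF cap(1)]) (auto simp: dot_def split: if_splits)
  next
    case (through y)
    then show ?thesis
      using outermost_first_prop outermost_last_prop by (intro out[OF through]) auto
  qed
qed

text \<open>Each face has a single non-propagating edge with at most one decoration, so the
  conditions on the order of colours are trivial and only the access to the walls needs an
  argument.\<close>

lemma deformable_one_cup:
  "deformable n (one_cup n p r (dot n p) (dot n r) (map (tag n p) ds))"
proof -
  let ?D = "one_cup n p r (dot n p) (dot n r) (map (tag n p) ds)"
  let ?w = "link_word p r (dot n p) (dot n r) (map (tag n p) ds)"
  have walls: "((\<exists>c\<in>set (?w x). black c) \<longrightarrow> outermost (lpos n) ?D x (link p r x)) \<and>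
    ((\<exists>c\<in>set (?w x). \<not> black c) \<longrightarrow> outermost (rpos n) ?D x (link p r x))" for x
  proof (intro conjI impI; elim bexE)
    fix c assume "c \<in> set (?w x)" "black c"
    then show "outermost (lpos n) ?D x (link p r x)"
      using outermost_decorated[of c ds x] by simp
  next
    fix c assume "c \<in> set (?w x)" "\<not> black c"
    then show "outermost (rpos n) ?D x (link p r x)"
      using outermost_decorated[of c ds x] by simp
  qed
  have face: "black_first (?w (F i))" if "link p r (F i) = F j" "F \<in> {North, South}" for F i j
    using that by (auto simp: dot_def black_first_def split: if_splits)
  have single: False if "link p r (F i) = F j" "link p r (F i') = F j'" "F \<in> {North, South}"
    "i < j" "j < i'" "i' < j'" for F i j i' j'
    using that by (auto split: if_splits)
  have "(\<forall>i w j. (F i, w, F j) \<in> arcs ?D \<and> i < j \<longrightarrow> black_first w) \<and>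
      (\<forall>i w j i' w' j'. (F i, w, F j) \<in> arcs ?D \<and> (F i', w', F j') \<in> arcs ?D \<and>
         i < j \<and> j < i' \<and> i' < j' \<longrightarrow> black_first (w @ w'))"
    if "F \<in> {North, South}" for F
    using face[OF _ that] single[OF _ _ that] unfolding arcs_one_cup by metis
  then show ?thesis
    unfolding deformable_def using walls by (simp add: arcs_one_cup)
qed

lemma one_cup_in_ddiagrams:
  "one_cup n p r (dot n p) (dot n r) (map (tag n p) ds) \<in> ddiagrams n"
proof -
  let ?D = "one_cup n p r (dot n p) (dot n r) (map (tag n p) ds)"
  have "fst ` set (map (tag n p) ds) \<subseteq> props ?D"
    unfolding props_one_cup set_map image_image using fst_tag[OF n p] by (rule image_subsetI)
  moreover have "w = beads i (map (tag n p) ds)" if "(North i, w, South j) \<in> arcs ?D" for i w j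
    using that unfolding arcs_one_cup by (auto split: if_splits)
  ultimately show ?thesis
    unfolding ddiagrams_def mem_Collect_eq a_val_one_cup[OF p] one_cup_simps
    using matching_one_cup[OF p r] deformable_one_cup by (metis zero_neq_one)
qed

end

section \<open>Moving the cup\<close>

lemma steps_True: "steps D' D True = (\<lambda>(x, w, y). (upper x, w, upper y)) ` arcs D'"
  and steps_False: "steps D' D False = (\<lambda>(x, w, y). (lower x, w, lower y)) ` arcs D"
  by (simp_all add: steps_def)

lemma upper_inject [simp]: "upper x = upper y \<longleftrightarrow> x = y"
  and lower_inject [simp]: "lower x = lower y \<longleftrightarrow> x = y"
  and outer_inject [simp]: "outer x = outer y \<longleftrightarrow> x = y"
  by (cases x; cases y; simp)+

lemma outer_neq_Mid [simp]: "outer x \<noteq> Mid k"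
  by (cases x) simp_all

lemma outer_eq_upper [simp]: "outer x = upper y \<longleftrightarrow> (\<exists>i. x = North i \<and> y = North i)"
  and outer_eq_lower [simp]: "outer x = lower y \<longleftrightarrow> (\<exists>i. x = South i \<and> y = South i)"
  by (cases x; cases y; auto)+

lemma Mid_eq_upper [simp]: "Mid k = upper x \<longleftrightarrow> x = South k"
  by (cases x) auto

lemma Mid_eq_lower [simp]: "Mid k = lower x \<longleftrightarrow> x = North k"
  by (cases x) auto

lemma Top_eq_upper [simp]: "Top k = upper x \<longleftrightarrow> x = North k"
  by (cases x) auto

lemma Bot_eq_lower [simp]: "Bot k = lower x \<longleftrightarrow> x = South k"
  by (cases x) auto

lemma Top_neq_lower [simp]: "Top k \<noteq> lower x"
  by (cases x) auto

lemma Bot_neq_upper [simp]: "Bot k \<noteq> upper x"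
  by (cases x) auto

lemma single_valued_steps:
  assumes "single_valued (arcs D')" "single_valued (arcs D)"
  shows "single_valued (steps D' D up)"
  using assms
  by (cases up) (auto simp: steps_True steps_False single_valued_def; blast)+

lemma walk_first_step:
  assumes "walk D' D up p w ks q"
  shows "\<exists>u q'. (p, u, q') \<in> steps D' D up"
  using assms by cases blast+

lemma outer_step:
  assumes "(outer x, u, q) \<in> steps D' D up"
  shows "(\<exists>y. (x, u, y) \<in> (if up then arcs D' else arcs D)) \<and> (up \<longleftrightarrow> (\<exists>i. x = North i))"
  using assms unfolding steps_def by (auto split: if_splits)

text \<open>Every step is forced by its starting point, and neither walk can stop early because an
  outer node is never a middle node.\<close>

lemma walk_unique:
  assumes "single_valued (arcs D')" "single_valued (arcs D)"
    and "walk D' D up p w ks q" "walk D' D up p w' ks' (outer y')" "q = outer y"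
  shows "w = w' \<and> y = y'"
proof -
  have step: "u = u' \<and> q = q'"
    if "(p, u, q) \<in> steps D' D up" "(p, u', q') \<in> steps D' D up" for p u q u' q' up
    using single_valuedD[OF single_valued_steps[OF assms(1,2)] that] by simp
  show ?thesis
    using assms(3,4,5)
  proof (induction arbitrary: w' ks' rule: walk.induct)
    case (single p w q up)
    from single(2) show ?case
    proof cases
      case single': single
      from step[OF single(1) single'(2)] single(3) show ?thesis by simp
    next
      case (cons u k v ks)
      from step[OF single(1) cons(3)] single(3) have "outer y = Mid k" by simp
      then show ?thesis by simp
    qed
  next
    case (cons p u k up v ks q)
    from cons.prems(1) show ?case
    proof cases
      case single
      from step[OF cons.hyps(1) single(2)] have "outer y' = Mid k" by simp
      then show ?thesis by simp
    next
      case cons': (cons u' k' v' ks'')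
      from step[OF cons.hyps(1) cons'(3)] have u: "u = u'" "k' = k" by auto
      with cons'(4) have "walk D' D (\<not> up) (Mid k) v' ks'' (outer y')" by simp
      from cons.IH[OF this cons.prems(2)] u cons'(1) show ?thesis by simp
    qed
  qed
qed

text \<open>Reduces the computation of all edges of a product to exhibiting one walk from each outer
  node: the node fixes the side on which a walk starts, and the rest is unique.\<close>

lemma conc_arcs_eqI:
  assumes sv: "single_valued (arcs D')" "single_valued (arcs D)"
    and dom: "\<And>x w y. (x, w, y) \<in> arcs D' \<union> arcs D \<Longrightarrow> x \<in> A"
    and walks: "\<And>x. x \<in> A \<Longrightarrow> \<exists>up ks. walk D' D up (outer x) (W x) ks (outer (L x))"
  shows "conc_arcs D' D = (\<lambda>x. (x, W x, L x)) ` A"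
proof (intro equalityI subsetI)
  fix e assume "e \<in> conc_arcs D' D"
  then obtain x w y up ks where e: "e = (x, w, y)" and wk: "walk D' D up (outer x) w ks (outer y)"
    unfolding conc_arcs_def by blast
  from walk_first_step[OF wk] obtain u q where "(outer x, u, q) \<in> steps D' D up"
    by blast
  from outer_step[OF this] have x: "x \<in> A" "up \<longleftrightarrow> (\<exists>i. x = North i)"
    using dom by (auto split: if_splits)
  from walks[OF x(1)] obtain up' ks' where wk': "walk D' D up' (outer x) (W x) ks' (outer (L x))"
    by blast
  from walk_first_step[OF wk'] obtain u' q' where "(outer x, u', q') \<in> steps D' D up'"
    by blast
  from outer_step[OF this] x(2) have "up' = up" by simp
  with wk' walk_unique[OF sv wk _ HOL.refl] have "w = W x" "y = L x"
    by simp_all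
  with e x show "e \<in> (\<lambda>x. (x, W x, L x)) ` A" by simp
next
  fix e assume "e \<in> (\<lambda>x. (x, W x, L x)) ` A"
  then obtain x where x: "x \<in> A" and e: "e = (x, W x, L x)" by blast
  from walks[OF x] show "e \<in> conc_arcs D' D"
    unfolding conc_arcs_def e by simp
qed

lemma walk_upper:
  assumes "(x, w, y) \<in> arcs D'"
  shows "walk D' D True (upper x) w [] (upper y)"
  using assms by (intro walk.single) (force simp: steps_True)

lemma walk_lower:
  assumes "(x, w, y) \<in> arcs D"
  shows "walk D' D False (lower x) w [] (lower y)"
  using assms by (intro walk.single) (force simp: steps_False)

lemma walk_upper_Cons:
  assumes "(x, w, South k) \<in> arcs D'" "walk D' D False (Mid k) v ks q"
  shows "walk D' D True (upper x) (w @ v) (k # ks) q"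
  using assms by (intro walk.cons) (force simp: steps_True)+

lemma walk_lower_Cons:
  assumes "(x, w, North k) \<in> arcs D" "walk D' D True (Mid k) v ks q"
  shows "walk D' D False (lower x) (w @ v) (k # ks) q"
  using assms by (intro walk.cons) (force simp: steps_False)+

lemma single_valued_arcs_one_cup: "single_valued (arcs (one_cup n p r u v vs))"
  by (auto simp: single_valued_def one_cup_def)

lemma beads_simps [simp]:
  "beads k [] = []" "beads k (vs @ vs') = beads k vs @ beads k vs'"
  "beads k (map (Pair l) w) = (if k = l then w else [])"
  by (auto simp: beads_def filter_map o_def)

lemma beads_map_fst:
  assumes "\<And>l. l \<in> fst ` set vs \<Longrightarrow> f l = k \<longleftrightarrow> l = k'"
  shows "beads k (map (map_prod f id) vs) = beads k' vs"
  using assms by (induction vs) (auto simp: beads_def)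

lemma concat_map_single:
  assumes "distinct xs" "t \<in> set xs" "\<And>x. x \<in> set xs \<Longrightarrow> x \<noteq> t \<Longrightarrow> f x = []"
  shows "concat (map f xs) = f t"
  using assms
proof (induction xs)
  case (Cons a xs)
  then show ?case
    by (cases "a = t") (auto simp: concat_eq_Nil_conv)
qed simp

section \<open>The product with a generator adjacent to the cup\<close>

definition slide :: "nat \<Rightarrow> nat \<Rightarrow> nat \<Rightarrow> nat" where
  "slide s t k = (if k = s then t else k)"

text \<open>A path coming down at \<open>t\<close> first turns at the cup of the lower factor, then
  at the cap of the upper factor, and only then follows the old edge at \<open>s\<close>. So the
  decorations picked up in the middle lie above the old ones; they will be \<open>u @ w\<close>,
  with \<open>u\<close> from that cup and \<open>w\<close> from that cap.\<close>

definition slide_vert :: "nat \<Rightarrow> nat \<Rightarrow> deco list \<Rightarrow> (nat \<times> deco) list \<Rightarrow> (nat \<times> deco) list" where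
  "slide_vert s t u vs = map (Pair t) u @ map (map_prod (slide s t) id) vs"

text \<open>In the middle, the cap \<open>{i, i + 1}\<close> of the upper factor is \<open>{s, m}\<close> and the cup \<open>{j, j + 1}\<close> of
  the lower factor is \<open>{m, t}\<close>; so the edge at \<open>s\<close> of the lower factor is prolonged to \<open>t\<close>.\<close>

context
  fixes n i j r s m t :: nat and u v w :: "deco list" and vs :: "(nat \<times> deco) list"
  assumes ij: "i \<in> {1..n + 1}" "j \<in> {1..n + 1}" and r: "r \<in> {1..n + 1}"
    and smt: "i = s \<and> i + 1 = m \<and> j = m \<and> j + 1 = t \<or> i = m \<and> i + 1 = s \<and> j = t \<and> j + 1 = m"
    and u: "rev u = u" and w: "rev w = w"
    and vs: "fst ` set vs \<subseteq> {1..n + 2} - {j, j + 1}"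
begin

abbreviation "cup_i \<equiv> one_cup n i i w w []"
abbreviation "cup_j \<equiv> one_cup n j r u v vs"

text \<open>\<open>slide s t\<close> is the increasing bijection from the nodes off the old cup to
  those off the new one; ranks are kept, and hence so are the lower ends of the edges.\<close>

lemma unskip_slide: "k \<noteq> j \<Longrightarrow> k \<noteq> j + 1 \<Longrightarrow> unskip i (slide s t k) = unskip j k"
  using smt by (auto simp: slide_def unskip_def)

lemma slide_props: "k \<noteq> j \<Longrightarrow> k \<noteq> j + 1 \<Longrightarrow> slide s t k \<noteq> i \<and> slide s t k \<noteq> i + 1"
  using smt by (auto simp: slide_def)

lemma slide_eq_iff: "k \<noteq> j \<Longrightarrow> k \<noteq> j + 1 \<Longrightarrow> k' \<noteq> j \<Longrightarrow> k' \<noteq> j + 1 \<Longrightarrow> slide s t k = slide s t k' \<longleftrightarrow> k = k'"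
  using smt by (auto simp: slide_def)

lemma slide_ex:
  assumes "k \<noteq> i" "k \<noteq> i + 1"
  shows "\<exists>l. k = slide s t l \<and> l \<noteq> j \<and> l \<noteq> j + 1"
proof -
  have "k = slide s t (if k = t then s else k)"
    using assms smt by (auto simp: slide_def)
  then show ?thesis using assms smt by (intro exI[of _ "if k = t then s else k"]) auto
qed

lemma beads_slide_vert:
  assumes "k \<noteq> j" "k \<noteq> j + 1"
  shows "beads (slide s t k) (slide_vert s t (u @ w) vs) =
    (if k = s then u @ w else []) @ beads k vs"
proof -
  have "beads (slide s t k) (map (map_prod (slide s t) id) vs) = beads k vs"
    using vs assms slide_eq_iff by (intro beads_map_fst) auto
  moreover have "slide s t k = t \<longleftrightarrow> k = s" using assms smt by (auto simp: slide_def)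
  ultimately show ?thesis
    unfolding slide_vert_def beads_simps by simp
qed

lemma conc_arcs_slide:
  "conc_arcs cup_i cup_j = arcs (one_cup n i r w v (slide_vert s t (u @ w) vs))"
proof -
  let ?vs = "slide_vert s t (u @ w) vs"
  have ms: "(South m, w, South s) \<in> arcs cup_i" "(South s, w, South m) \<in> arcs cup_i"
    and mt: "(North m, u, North t) \<in> arcs cup_j" "(North t, u, North m) \<in> arcs cup_j"
    using ij smt u w by (auto simp: arcs_one_cup)
  have vert: "(North k, [], South k) \<in> arcs cup_i" "(South k, [], North k) \<in> arcs cup_i"
    if "k \<in> {1..n + 2}" "k \<noteq> i" "k \<noteq> i + 1" for k
    using that by (auto simp: arcs_one_cup skip_unskip)
  have bot: "(North k, beads k vs, South (skip r (unskip j k))) \<in> arcs cup_j"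
      "(South (skip r (unskip j k)), rev (beads k vs), North k) \<in> arcs cup_j"
    if "k \<in> {1..n + 2}" "k \<noteq> j" "k \<noteq> j + 1" for k
    using that link_in_nodes[of "North k" n j r] ij r
    by (auto simp: arcs_one_cup skip_unskip unskip_skip)
  have t: "t \<in> {1..n + 2}" "t \<noteq> i" "t \<noteq> i + 1" and s: "s \<in> {1..n + 2}" "s \<noteq> j" "s \<noteq> j + 1"
    using smt ij by auto
  have down: "\<exists>up ks. walk cup_i cup_j up (Top (slide s t k)) (beads (slide s t k) ?vs) ks
      (Bot (skip r (unskip i (slide s t k))))"
    if k: "k \<in> {1..n + 2}" "k \<noteq> j" "k \<noteq> j + 1" for k
  proof (cases "k = s")
    case True
    have "walk cup_i cup_j True (upper (North t)) ([] @ u @ w @ beads s vs) [t, m, s]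
        (lower (South (skip r (unskip j s))))"
      using walk_upper_Cons[OF vert(1)[OF t] walk_lower_Cons[OF mt(2), unfolded lower.simps,
        OF walk_upper_Cons[OF ms(1), unfolded upper.simps,
          OF walk_lower[OF bot(1)[OF s], unfolded lower.simps]]]] by simp
    then show ?thesis
      using True beads_slide_vert[OF k(2,3)] unskip_slide[OF k(2,3)]
      by (auto simp: slide_def)
  next
    case False
    then have k': "slide s t k = k" "k \<noteq> i" "k \<noteq> i + 1"
      using slide_props[OF k(2,3)] by (auto simp: slide_def)
    have "walk cup_i cup_j True (upper (North k)) ([] @ beads k vs) [k]
        (lower (South (skip r (unskip j k))))"
      using walk_upper_Cons[OF vert(1)[OF k(1) k'(2,3)]
          walk_lower[OF bot(1)[OF k], unfolded lower.simps]] by simp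
    then show ?thesis
      using False beads_slide_vert[OF k(2,3)] unskip_slide[OF k(2,3)] k'
      by auto
  qed
  \<comment> \<open>The same walks backwards; this is where \<open>u\<close> and \<open>w\<close>
    have to be palindromes.\<close>
  have up: "\<exists>up ks. walk cup_i cup_j up (Bot (skip r (unskip i (slide s t k))))
      (rev (beads (slide s t k) ?vs)) ks
      (Top (slide s t k))"
    if k: "k \<in> {1..n + 2}" "k \<noteq> j" "k \<noteq> j + 1" for k
  proof (cases "k = s")
    case True
    have "walk cup_i cup_j False (lower (South (skip r (unskip j s))))
        (rev (beads s vs) @ w @ u @ []) [s, m, t]
        (upper (North t))"
      using walk_lower_Cons[OF bot(2)[OF s] walk_upper_Cons[OF ms(2), unfolded upper.simps,
        OF walk_lower_Cons[OF mt(1), unfolded lower.simps,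
          OF walk_upper[OF vert(2)[OF t], unfolded upper.simps]]]] by simp
    then show ?thesis
      using True beads_slide_vert[OF k(2,3)] unskip_slide[OF k(2,3)] u w
      by (auto simp: slide_def)
  next
    case False
    then have k': "slide s t k = k" "k \<noteq> i" "k \<noteq> i + 1"
      using slide_props[OF k(2,3)] by (auto simp: slide_def)
    have "walk cup_i cup_j False (lower (South (skip r (unskip j k)))) (rev (beads k vs) @ []) [k]
        (upper (North k))"
      using walk_lower_Cons[OF bot(2)[OF k]
        walk_upper[OF vert(2)[OF k(1) k'(2,3)], unfolded upper.simps]] by simp
    then show ?thesis
      using False beads_slide_vert[OF k(2,3)] unskip_slide[OF k(2,3)] k'
      by auto
  qed
  have slide_range: "k \<in> {1..n + 2}" if "slide s t k \<in> {1..n + 2}" for k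
    using that s by (auto simp: slide_def split: if_splits)
  have "\<exists>up ks. walk cup_i cup_j up (outer x) (link_word i r w v ?vs x) ks (outer (link i r x))"
    if x: "x \<in> nodes n" for x
  proof (cases x)
    case (North k)
    show ?thesis
    proof (cases "k = i \<or> k = i + 1")
      case True
      then have "walk cup_i cup_j True (upper x) (link_word i r w v ?vs x) [] (upper (link i r x))"
        using North x w by (intro walk_upper) (auto simp: arcs_one_cup)
      moreover have "outer x = upper x" "outer (link i r x) = upper (link i r x)"
        using True North by auto
      ultimately show ?thesis by metis
    next
      case False
      then obtain l where l: "k = slide s t l" "l \<noteq> j" "l \<noteq> j + 1"
        using slide_ex by metis
      then show ?thesis
        using North False x down[OF slide_range, of l] by simp
    qed
  next
    case (South k)
    show ?thesis
    proof (cases "k = r \<or> k = r + 1")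
      case True
      then have "walk cup_i cup_j False (lower x) (link_word i r w v ?vs x) [] (lower (link i r x))"
        using South x by (intro walk_lower) (auto simp: arcs_one_cup)
      moreover have "outer x = lower x" "outer (link i r x) = lower (link i r x)"
        using True South by auto
      ultimately show ?thesis by metis
    next
      case False
      define k' where "k' = skip i (unskip r k)"
      have k': "k' \<noteq> i" "k' \<noteq> i + 1" "k = skip r (unskip i k')"
        using False by (auto simp: k'_def unskip_skip skip_unskip)
      then obtain l where l: "k' = slide s t l" "l \<noteq> j" "l \<noteq> j + 1"
        using slide_ex by metis
      have "link i r (South k) \<in> nodes n" using link_in_nodes[OF x ij(1) r] South by simp
      moreover have y: "link i r (South k) = North k'"
          "link_word i r w v ?vs (South k)
            = rev (beads k' ?vs)"
        using False by (simp_all add: k'_def)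
      ultimately have "k' \<in> {1..n + 2}" by simp
      then have "l \<in> {1..n + 2}" using slide_range l(1) by blast
      from up[OF this l(2,3)] show ?thesis
        unfolding l(1)[symmetric] k'(3)[symmetric] South y outer.simps .
    qed
  qed
  then show ?thesis
    unfolding one_cup_def[of n i r w] ddiag.select_convs
    by (intro conc_arcs_eqI single_valued_arcs_one_cup) (auto simp: arcs_one_cup)
qed

text \<open>A loop would alternate between the cap at \<open>i\<close> and the cup at
  \<open>j\<close>, but these share only the node \<open>m\<close> and so form an open path.
  Starting at the leftmost node forces the beginning \<open>i\<close>, \<open>i + 1\<close>.\<close>

lemma conc_loops_slide: "conc_loops cup_i cup_j = {#}"
proof -
  have "\<not> mid_loop cup_i cup_j k x" for k x
  proof
    assume "mid_loop cup_i cup_j k x"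
    then obtain ks where wk: "walk cup_i cup_j True (Mid k) x ks (Mid k)" and ks: "\<forall>j\<in>set ks. k < j"
      unfolding mid_loop_def by blast
    have mid_up: "{k, l} = {i, i + 1}" if "(Mid k, y, Mid l) \<in> steps cup_i cup_j True" for k l y
      using that by (auto simp: steps_True arcs_one_cup split: if_splits)
    have mid_down: "{k, l} = {j, j + 1}" if "(Mid k, y, Mid l) \<in> steps cup_i cup_j False" for k l y
      using that by (auto simp: steps_False arcs_one_cup split: if_splits)
    from wk show False
    proof cases
      case single
      from mid_up[OF this(2)] show False by (auto simp: doubleton_eq_iff)
    next
      case (cons y l v ls)
      then have kl: "k = i" "l = i + 1"
        using mid_up[of k y l] ks by (auto simp: doubleton_eq_iff)
      from cons(4) have "walk cup_i cup_j False (Mid l) v ls (Mid k)" by simp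
      then show False
      proof cases
        case single
        from mid_down[OF this(2)] kl show False using smt by (auto simp: doubleton_eq_iff)
      next
        case (cons y l' v ls)
        from mid_down[OF cons(3)] kl smt have "l' = i + 2" by (auto simp: doubleton_eq_iff)
        moreover from cons(4) have "walk cup_i cup_j True (Mid l') v ls (Mid k)" by simp
        then obtain y' q where "(Mid l', y', Mid q) \<in> steps cup_i cup_j True"
          by cases auto
        ultimately show False using mid_up by (fastforce simp: doubleton_eq_iff)
      qed
    qed
  qed
  then show ?thesis by (simp add: conc_loops_def)
qed

text \<open>An edge of the product is identified by its lower end, which is inherited from the lower
  factor. This gives the uniqueness behind the definite descriptions in \<open>mid_word\<close> and
  \<open>retag\<close>.\<close>

lemma prop_arcs_slide:
  assumes "k \<in> {1..n + 2}" "k \<noteq> j" "k \<noteq> j + 1"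
  shows "(North l, y, South (skip r (unskip j k))) \<in> conc_arcs cup_i cup_j
    \<longleftrightarrow> l = slide s t k \<and> y = (if k = s then u @ w else []) @ beads k vs"
proof -
  have "skip r (unskip i l) = skip r (unskip j k) \<longleftrightarrow> l = slide s t k" if "l \<noteq> i" "l \<noteq> i + 1"
    using that unskip_slide[OF assms(2,3)] slide_props[OF assms(2,3)]
    by (metis skip_unskip unskip_skip)
  moreover have "slide s t k \<in> {1..n + 2}"
    using assms smt ij by (auto simp: slide_def)
  ultimately show ?thesis
    using slide_props[OF assms(2,3)] unskip_slide[OF assms(2,3)]
    unfolding conc_arcs_slide arcs_one_cup beads_slide_vert[OF assms(2,3), symmetric] by auto
qed

lemma mid_word_slide:
  assumes k: "k \<in> {1..n + 2}" "k \<noteq> j" "k \<noteq> j + 1"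
  shows "mid_word cup_i cup_j (slide s t k) = (if k = s then u @ w else [])"
  unfolding mid_word_def
proof (rule the_equality)
  let ?b = "skip r (unskip j k)"
  have "link j r (North k) \<in> nodes n"
    using k by (intro link_in_nodes ij r) auto
  then have "(North k, beads k vs, South ?b) \<in> arcs cup_j"
    using k by (auto simp: arcs_one_cup)
  moreover have "slide s t k \<in> {1..n + 2}"
    using k smt ij by (auto simp: slide_def)
  then have "(North (slide s t k), [], South (slide s t k)) \<in> arcs cup_i"
    using slide_props[OF k(2,3)] by (auto simp: arcs_one_cup skip_unskip)
  moreover have "(North (slide s t k), (if k = s then u @ w else []) @ beads k vs, South ?b)
      \<in> conc_arcs cup_i cup_j"
    by (simp add: prop_arcs_slide[OF k])
  ultimately show "\<exists>u' k' l v' b. (North (slide s t k), u', South k') \<in> arcs cup_i \<and>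
      (North l, v', South b) \<in> arcs cup_j \<and>
      (North (slide s t k), u' @ (if k = s then u @ w else []) @ v', South b)
        \<in> conc_arcs cup_i cup_j"
    by (intro exI[of _ "[]"] exI[of _ "slide s t k"] exI[of _ k] exI[of _ "beads k vs"]
        exI[of _ ?b])
      (simp only: append_Nil simp_thms)
next
  fix x
  assume "\<exists>u' k' l v' b. (North (slide s t k), u', South k') \<in> arcs cup_i \<and>
      (North l, v', South b) \<in> arcs cup_j \<and>
      (North (slide s t k), u' @ x @ v', South b) \<in> conc_arcs cup_i cup_j"
  then obtain u' k' l v' b where upper_arc: "(North (slide s t k), u', South k') \<in> arcs cup_i"
    and lower_arc: "(North l, v', South b) \<in> arcs cup_j"
    and c: "(North (slide s t k), u' @ x @ v', South b) \<in> conc_arcs cup_i cup_j"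
    by blast
  have u': "u' = []" using upper_arc by (auto simp: arcs_one_cup split: if_splits)
  have b: "b = skip r (unskip j k)"
    using c slide_props[OF k(2,3)] unskip_slide[OF k(2,3)]
    by (auto simp: conc_arcs_slide arcs_one_cup)
  have "l \<noteq> j \<and> l \<noteq> j + 1 \<and> v' = beads l vs \<and> b = skip r (unskip j l)"
    using lower_arc by (auto simp: arcs_one_cup split: if_splits)
  moreover from this have "l = k" using b k by (metis skip_unskip unskip_skip)
  ultimately have "v' = beads k vs" by simp
  then show "x = (if k = s then u @ w else [])"
    using c unfolding u' b prop_arcs_slide[OF k] by simp
qed

lemma retag_slide:
  assumes k: "k \<in> {1..n + 2}" "k \<noteq> j" "k \<noteq> j + 1"
  shows "retag cup_i cup_j k = slide s t k"
  unfolding retag_def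
proof (rule the_equality)
  let ?b = "skip r (unskip j k)"
  have "link j r (North k) \<in> nodes n"
    using k by (intro link_in_nodes ij r) auto
  then have "(North k, beads k vs, South ?b) \<in> arcs cup_j"
    using k by (auto simp: arcs_one_cup)
  then show "\<exists>v w b. (North k, v, South b) \<in> arcs cup_j \<and>
      (North (slide s t k), w, South b) \<in> conc_arcs cup_i cup_j"
    using prop_arcs_slide[OF k] by blast
next
  fix l
  assume "\<exists>v w b. (North k, v, South b) \<in> arcs cup_j \<and>
    (North l, w, South b) \<in> conc_arcs cup_i cup_j"
  then obtain v' w' b where lower_arc: "(North k, v', South b) \<in> arcs cup_j"
    and c: "(North l, w', South b) \<in> conc_arcs cup_i cup_j" by blast
  from lower_arc k have "b = skip r (unskip j k)" by (auto simp: arcs_one_cup)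
  then show "l = slide s t k" using prop_arcs_slide[OF k] c by blast
qed

lemma conc_slide: "conc cup_i cup_j = one_cup n i r w v (slide_vert s t (u @ w) vs)"
proof -
  define A where "A = {1..n + 2} - {i, i + 1}"
  have A: "{k. \<exists>w l. (North k, w, South l) \<in> conc_arcs cup_i cup_j} = A"
    unfolding conc_arcs_slide props_def[symmetric] props_one_cup A_def ..
  have "t \<in> A" and s: "s \<in> {1..n + 2}" "s \<noteq> j" "s \<noteq> j + 1"
    using smt ij by (auto simp: A_def)
  have mid: "mid_word cup_i cup_j k = (if k = t then u @ w else [])" if kA: "k \<in> A" for k
  proof -
    obtain l where l: "k = slide s t l" "l \<noteq> j" "l \<noteq> j + 1"
      using slide_ex[of k] kA unfolding A_def by blast
    then have "l \<in> {1..n + 2}" using kA s by (auto simp: slide_def A_def split: if_splits)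
    from mid_word_slide[OF this l(2,3)] show ?thesis
      using l smt by (auto simp: slide_def)
  qed
  \<comment> \<open>Only the edge at \<open>t\<close> meets decorations in the middle, so the order
    in which the edges are listed does not show.\<close>
  have "concat (map (\<lambda>k. map (Pair k) (mid_word cup_i cup_j k)) (sorted_list_of_set A)) =
      map (Pair t) (mid_word cup_i cup_j t)"
    using \<open>t \<in> A\<close> mid by (intro concat_map_single) (auto simp: A_def)
  moreover have "map (map_prod (retag cup_i cup_j) id) vs = map (map_prod (slide s t) id) vs"
  proof (rule map_cong[OF HOL.refl])
    fix b assume "b \<in> set vs"
    then have "fst b \<in> {1..n + 2}" "fst b \<noteq> j" "fst b \<noteq> j + 1"
      using vs by auto
    from retag_slide[OF this] show "map_prod (retag cup_i cup_j) id b = map_prod (slide s t) id b"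
      by (cases b) simp
  qed
  ultimately have "conc_vert cup_i cup_j = slide_vert s t (u @ w) vs"
    unfolding conc_vert_def A using mid[OF \<open>t \<in> A\<close>] by (simp add: slide_vert_def)
  moreover have "a_val \<lparr>arcs = conc_arcs cup_i cup_j, vert = [],
      loops = conc_loops cup_i cup_j\<rparr> = 1"
    unfolding conc_arcs_slide using a_val_one_cup[OF ij(1)] by (simp add: a_val_def)
  ultimately show ?thesis
    unfolding conc_def Let_def conc_loops_slide conc_arcs_slide
    by (simp add: one_cup_def)
qed

end

lemma simple_diag_one_cup:
  assumes "i \<in> {1..n + 1}" "rev w = w"
  shows "simple_diag n i w = one_cup n i i w w []"
proof -
  have "(x, u, y) \<in> arcs (simple_diag n i w) \<longleftrightarrow> (x, u, y) \<in> arcs (one_cup n i i w w [])" for x u y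
    unfolding arcs_one_cup simple_diag_def using assms
    by (cases x) (auto simp: skip_unskip)
  then have "arcs (simple_diag n i w) = arcs (one_cup n i i w w [])" by auto
  then show ?thesis by (simp add: simple_diag_def one_cup_def)
qed

section \<open>The product with the identity diagram\<close>

lemma arcs_id_diag:
  "(x, w, y) \<in> arcs (id_diag n) \<longleftrightarrow>
     w = [] \<and> (\<exists>j\<in>{1..n + 2}. x = North j \<and> y = South j \<or> x = South j \<and> y = North j)"
  by (auto simp: id_diag_def)

context
  fixes n i :: nat and w :: "deco list"
  assumes i: "i \<in> {1..n + 1}" and w: "rev w = w"
begin

lemma conc_arcs_id: "conc_arcs (one_cup n i i w w []) (id_diag n) = arcs (one_cup n i i w w [])"
proof -
  let ?E = "one_cup n i i w w []"
  have id: "(North k, [], South k) \<in> arcs (id_diag n)" "(South k, [], North k) \<in> arcs (id_diag n)"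
    if "k \<in> {1..n + 2}" for k
    using that by (auto simp: arcs_id_diag)
  have "\<exists>up ks. walk ?E (id_diag n) up (outer x) (link_word i i w w [] x) ks (outer (link i i x))"
    if x: "x \<in> nodes n" for x
  proof (cases x)
    case (North k)
    have arc: "(x, link_word i i w w [] x, link i i x) \<in> arcs ?E"
      using x by (simp add: arcs_one_cup)
    show ?thesis
    proof (cases "k = i \<or> k = i + 1")
      case True
      then have link: "link i i (North k) = North (if k = i then i + 1 else i)" by auto
      from walk_upper[OF arc[unfolded North link]] show ?thesis
        unfolding North link upper.simps outer.simps by blast
    next
      case False
      then have link: "link i i (North k) = South k" by (simp add: skip_unskip)
      have "k \<in> {1..n + 2}" using x North by simp
      from walk_upper_Cons[OF arc[unfolded North link]
          walk_lower[OF id(1)[OF this], unfolded lower.simps]]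
      show ?thesis unfolding North link upper.simps lower.simps outer.simps append_Nil2 by blast
    qed
  next
    case (South k)
    have k: "k \<in> {1..n + 2}" using x South by simp
    have arc: "(x, link_word i i w w [] x, link i i x) \<in> arcs ?E"
      using x by (simp add: arcs_one_cup)
    show ?thesis
    proof (cases "k = i \<or> k = i + 1")
      case True
      define l where "l = (if k = i then i + 1 else i)"
      have link: "link i i (South k) = South l" using True by (auto simp: l_def)
      have l: "l \<in> {1..n + 2}" using i by (auto simp: l_def)
      from walk_lower_Cons[OF id(2)[OF k]
          walk_upper_Cons[OF arc[unfolded South link], unfolded upper.simps,
          OF walk_lower[OF id(1)[OF l], unfolded lower.simps]]]
      show ?thesis unfolding South link lower.simps outer.simps append_Nil append_Nil2 by blast
    next
      case False
      then have link: "link i i (South k) = North k" by (simp add: skip_unskip)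
      from walk_lower_Cons[OF id(2)[OF k]
          walk_upper[OF arc[unfolded South link], unfolded upper.simps]]
      show ?thesis unfolding South link upper.simps lower.simps outer.simps append_Nil by blast
    qed
  qed
  then show ?thesis
    unfolding one_cup_def[of n i i w w] ddiag.select_convs
    using i
    by (intro conc_arcs_eqI
          single_valued_arcs_one_cup[of n i i w w "[]", unfolded one_cup_def ddiag.select_convs])
      (auto simp: arcs_id_diag single_valued_def one_cup_def)
qed

lemma conc_loops_id: "conc_loops (one_cup n i i w w []) (id_diag n) = {#}"
proof -
  let ?E = "one_cup n i i w w []"
  have "\<not> mid_loop ?E (id_diag n) k x" for k x
  proof
    assume "mid_loop ?E (id_diag n) k x"
    then obtain ks where "walk ?E (id_diag n) True (Mid k) x ks (Mid k)"
      unfolding mid_loop_def by blast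
    then show False
    proof cases
      case single
      then show False using link_neq[of i i "South k"] by (auto simp: steps_True arcs_one_cup)
    next
      case (cons y l v ls)
      from cons(4) show False
        by cases (auto simp: steps_False arcs_id_diag)
    qed
  qed
  then show ?thesis by (simp add: conc_loops_def id_diag_def)
qed

text \<open>The base case of \<open>diag_prod\<close>: the identity has no cup and so is not of the
  form \<open>one_cup\<close>.\<close>

lemma conc_id_diag: "conc (one_cup n i i w w []) (id_diag n) = one_cup n i i w w []"
proof -
  let ?E = "one_cup n i i w w []"
  have A: "{k. \<exists>w l. (North k, w, South l) \<in> conc_arcs ?E (id_diag n)} = {1..n + 2} - {i, i + 1}"
    unfolding conc_arcs_id props_def[symmetric] props_one_cup ..
  have mid: "mid_word ?E (id_diag n) k = []" if k: "k \<in> {1..n + 2} - {i, i + 1}" for k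
    unfolding mid_word_def
  proof (rule the_equality)
    have "(North k, [], South k) \<in> arcs ?E" "(North k, [], South k) \<in> arcs (id_diag n)"
      using k by (auto simp: arcs_one_cup arcs_id_diag skip_unskip)
    then show "\<exists>u l l' v b. (North k, u, South l) \<in> arcs ?E
        \<and> (North l', v, South b) \<in> arcs (id_diag n)
        \<and> (North k, u @ [] @ v, South b) \<in> conc_arcs ?E (id_diag n)"
      unfolding conc_arcs_id
      by (intro exI[of _ "[]"] exI[of _ k]) simp
  next
    fix m
    assume "\<exists>u l l' v b. (North k, u, South l) \<in> arcs ?E
        \<and> (North l', v, South b) \<in> arcs (id_diag n)
        \<and> (North k, u @ m @ v, South b) \<in> conc_arcs ?E (id_diag n)"
    then show "m = []"
      using k unfolding conc_arcs_id by (auto simp: arcs_one_cup)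
  qed
  have "concat (map (\<lambda>k. map (Pair k) (mid_word ?E (id_diag n) k))
      (sorted_list_of_set ({1..n + 2} - {i, i + 1}))) = []"
    using mid by (auto simp: concat_eq_Nil_conv)
  then have "conc_vert ?E (id_diag n) = []"
    unfolding conc_vert_def A by (simp add: id_diag_def)
  moreover have "a_val \<lparr>arcs = conc_arcs ?E (id_diag n), vert = [],
      loops = conc_loops ?E (id_diag n)\<rparr> = 1"
    unfolding conc_arcs_id using a_val_one_cup[OF i] by (simp add: a_val_def)
  ultimately show ?thesis
    unfolding conc_def Let_def conc_loops_id conc_arcs_id
    by (simp add: one_cup_def)
qed

end

section \<open>Words with unit steps and their undecorated products\<close>

definition adjacent :: "nat \<Rightarrow> nat \<Rightarrow> bool" where
  "adjacent i j \<longleftrightarrow> j = i + 1 \<or> i = j + 1"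

text \<open>What the zigzag form contributes to the diagrams: the cup moves by one place at a time.
  Where the word turns is left open, so monotone words in type A are covered as well.\<close>

definition lattice_path :: "nat \<Rightarrow> nat list \<Rightarrow> bool" where
  "lattice_path n a \<longleftrightarrow> a \<noteq> [] \<and> set a \<subseteq> {1..n + 1} \<and> successively adjacent a"

lemma lattice_path_Cons:
  "lattice_path n (i # a) \<longleftrightarrow>
     i \<in> {1..n + 1} \<and> (a = [] \<or> adjacent i (hd a) \<and> lattice_path n a)"
  by (cases a) (auto simp: lattice_path_def)

lemma lattice_path_ends:
  assumes "lattice_path n a"
  shows "hd a \<in> {1..n + 1}" "last a \<in> {1..n + 1}"
  using assms unfolding lattice_path_def by (meson hd_in_set last_in_set subsetD)+

text \<open>The first propagating edge changes only when the cup reaches or leaves position 1, and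
  then it is the edge moved from \<open>s\<close> to \<open>t\<close>; similarly at
  \<open>n + 1\<close> for the last one. Decorations arise in the middle only in these situations,
  so the tag \<open>t\<close> is the right one for them too.\<close>

lemma slide_vert_tag:
  assumes "n \<ge> 2" "i = s \<and> j = s + 1 \<and> t = s + 2 \<or> i = t + 1 \<and> s = t + 2 \<and> j = t"
    "i \<in> {1..n + 1}" "j \<in> {1..n + 1}"
  shows "slide_vert s t (dot n j @ dot n i) (map (tag n j) ds) =
    map (tag n i) (dot n j @ dot n i @ ds)"
proof -
  have "map_prod (slide s t) id (tag n j c) = tag n i c" for c
    using assms by (auto simp: slide_def tag_def first_prop_def last_prop_def)
  moreover have "(t, c) = tag n i c" if "c \<in> set (dot n j @ dot n i)" for c
    using assms that by (auto simp: dot_def tag_def first_prop_def last_prop_def split: if_splits)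
  ultimately show ?thesis by (auto simp: slide_vert_def)
qed

context
  fixes n i j r :: nat
  assumes n: "n \<ge> 2" and adj: "adjacent i j"
    and range: "i \<in> {1..n + 1}" "j \<in> {1..n + 1}" "r \<in> {1..n + 1}"
begin

lemma conc_adjacent:
  "conc (one_cup n i i (dot n i) (dot n i) []) (one_cup n j r (dot n j) v (map (tag n j) ds)) =
     one_cup n i r (dot n i) v (map (tag n i) (dot n j @ dot n i @ ds))"
proof -
  have vs: "fst ` set (map (tag n j) ds) \<subseteq> {1..n + 2} - {j, j + 1}"
    unfolding set_map image_image using fst_tag[OF n range(2)] by (rule image_subsetI)
  from adj show ?thesis
    unfolding adjacent_def
  proof (elim disjE)
    assume "j = i + 1"
    then show ?thesis
      using conc_slide[OF range, where s = i and m = "i + 1" and t = "i + 2", OF _ _ _ vs]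
        slide_vert_tag[OF n _ range(1,2), of i "i + 2"] by simp
  next
    assume "i = j + 1"
    then show ?thesis
      using conc_slide[OF range, where s = "i + 1" and m = i and t = j, OF _ _ _ vs]
        slide_vert_tag[OF n _ range(1,2), of "j + 2" j] by simp
  qed
qed

lemma conc_adjacent_plain:
  "conc (one_cup n i i [] [] []) (one_cup n j r [] [] []) = one_cup n i r [] [] []"
  using adj unfolding adjacent_def
proof (elim disjE)
  assume "j = i + 1"
  then show ?thesis
    using conc_slide[OF range, where s = i and m = "i + 1" and t = "i + 2" and u = "[]" and w = "[]"
        and v = "[]" and vs = "[]"] by (simp add: slide_vert_def)
next
  assume "i = j + 1"
  then show ?thesis
    using conc_slide[OF range, where s = "i + 1" and m = i and t = j and u = "[]" and w = "[]"
        and v = "[]" and vs = "[]"] by (simp add: slide_vert_def)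
qed

end

lemma diag_prod_lattice_path:
  assumes "n \<ge> 2" "lattice_path n a"
  shows "diag_prod n a = one_cup n (hd a) (last a) [] [] []"
  using assms(2)
proof (induction a)
  case (Cons i a)
  have prod: "diag_prod n (i # a) = conc (simple_diag n i []) (diag_prod n a)"
    by (simp add: diag_prod_def)
  show ?case
  proof (cases "a = []")
    case True
    with Cons show ?thesis
      unfolding prod by (simp add: lattice_path_Cons simple_diag_one_cup conc_id_diag diag_prod_def)
  next
    case False
    with Cons have a: "lattice_path n a" "adjacent i (hd a)" "i \<in> {1..n + 1}"
      by (simp_all add: lattice_path_Cons)
    with lattice_path_ends[OF a(1)] False Cons.IH assms(1) show ?thesis
      unfolding prod by (simp add: simple_diag_one_cup conc_adjacent_plain del: atLeastAtMost_iff)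
  qed
qed (simp add: lattice_path_def)

lemma conc_South_arc:
  assumes "(South k, w, South l) \<in> arcs D"
  shows "(South k, w, South l) \<in> arcs (conc D' D)"
proof -
  have "(South k, w, South l) \<in> conc_arcs D' D"
    using walk_lower[OF assms, of D'] unfolding conc_arcs_def by auto
  then show ?thesis by (simp add: conc_def Let_def)
qed

text \<open>South arcs survive every multiplication from above, so a product that has once acquired two caps
  never becomes a diagram with a single cap again.  Hence no loop can arise in a product of simple
  diagrams, along a reduced word, that ends in such a diagram.\<close>

definition two_caps :: "ddiag \<Rightarrow> bool" where
  "two_caps D \<longleftrightarrow> (\<exists>k w l k' w' l'. (South k, w, South l) \<in> arcs D \<and> (South k', w', South l') \<in> arcs D
     \<and> k' \<noteq> k \<and> k' \<noteq> l \<and> k \<noteq> l)"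

lemma two_caps_conc: "two_caps D \<Longrightarrow> two_caps (conc D' D)"
  unfolding two_caps_def using conc_South_arc by meson

lemma not_two_caps_one_cup: "arcs D = arcs (one_cup n p r u v vs) \<Longrightarrow> \<not> two_caps D"
  unfolding two_caps_def by (auto simp: arcs_one_cup split: if_splits)

text \<open>The cap of the upper factor misses the cup of the lower one, so it ties together the two
  lower edges that start at \<open>i\<close> and \<open>i + 1\<close>, which yields a second cap
  beside the one at \<open>r\<close>.\<close>

lemma two_caps_distant:
  assumes "i \<in> {1..n + 1}" "j \<in> {1..n + 1}" "r \<in> {1..n + 1}" "i \<noteq> j" "\<not> adjacent i j"
  shows "two_caps (conc (one_cup n i i [] [] []) (one_cup n j r [] [] []))"
proof -
  let ?E = "one_cup n i i [] [] []" and ?D = "one_cup n j r [] [] []"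
  define k l where "k = skip r (unskip j i)" and "l = skip r (unskip j (i + 1))"
  have ne: "i \<noteq> j" "i \<noteq> j + 1" "i + 1 \<noteq> j" "i + 1 \<noteq> j + 1"
    using assms by (auto simp: adjacent_def)
  have kl: "skip j (unskip r k) = i" "skip j (unskip r l) = i + 1"
      "k \<noteq> r" "k \<noteq> r + 1" "k \<in> {1..n + 2}"
    using ne link_in_nodes[of "North i" n j r] assms
    by (auto simp: k_def l_def unskip_skip skip_unskip)
  have "(South k, [], North i) \<in> arcs ?D"
    using kl by (auto simp: arcs_one_cup)
  moreover have "(South i, [], South (i + 1)) \<in> arcs ?E"
    using assms by (auto simp: arcs_one_cup)
  moreover have "(North (i + 1), [], South l) \<in> arcs ?D"
    using ne assms by (auto simp: arcs_one_cup l_def)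
  ultimately have "walk ?E ?D False (Bot k) [] [i, i + 1] (Bot l)"
    using walk_lower_Cons[OF _ walk_upper_Cons[of "South i", unfolded upper.simps,
        OF _ walk_lower[of "North (i + 1)", unfolded lower.simps]]] by fastforce
  then have "(South k, [], South l) \<in> conc_arcs ?E ?D"
    unfolding conc_arcs_def by auto
  then have "(South k, [], South l) \<in> arcs (conc ?E ?D)"
    by (simp add: conc_def Let_def)
  moreover have "(South r, [], South (r + 1)) \<in> arcs (conc ?E ?D)"
    using assms by (intro conc_South_arc) (auto simp: arcs_one_cup)
  ultimately show ?thesis
    unfolding two_caps_def using kl by (metis n_not_Suc_n Suc_eq_plus1)
qed

text \<open>Read the word from the right: the first pair of neighbours that are not adjacent
  consists of distinct commuting letters and produces a second cap, which then persists.\<close>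

lemma lattice_path_or_two_caps:
  assumes "n \<ge> 2" "set a \<subseteq> {1..n + 1}" "successively (\<noteq>) a" "a \<noteq> []"
  shows "lattice_path n a \<or> two_caps (diag_prod n a)"
  using assms(2-)
proof (induction a)
  case (Cons i a)
  have prod: "diag_prod n (i # a) = conc (simple_diag n i []) (diag_prod n a)"
    by (simp add: diag_prod_def)
  show ?case
  proof (cases "a = []")
    case True
    then show ?thesis using Cons by (simp add: lattice_path_Cons)
  next
    case False
    then have a: "set a \<subseteq> {1..n + 1}" "successively (\<noteq>) a" "i \<noteq> hd a" "i \<in> {1..n + 1}"
      using Cons.prems by (cases a; auto)+
    show ?thesis
    proof (cases "lattice_path n a")
      case True
      from lattice_path_ends[OF True] have "two_caps (diag_prod n (i # a))" if "\<not> adjacent i (hd a)"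
        using two_caps_distant that a(3,4) diag_prod_lattice_path[OF assms(1) True]
        unfolding prod by (simp add: simple_diag_one_cup)
      then show ?thesis using True a(4) by (auto simp: lattice_path_Cons)
    next
      case ne: False
      then show ?thesis using Cons.IH[OF a(1,2) False] two_caps_conc unfolding prod by blast
    qed
  qed
qed simp

section \<open>Quotients of free algebras\<close>

lemma free_alg_simps [simp]:
  "carrier (free_alg S f e) = {x. Poly_Mapping.keys x \<subseteq> S}"
  "\<one>\<^bsub>free_alg S f e\<^esub> = Poly_Mapping.single e 1"
  "\<zero>\<^bsub>free_alg S f e\<^esub> = 0"
  "x \<oplus>\<^bsub>free_alg S f e\<^esub> y = x + y"
  "c \<odot>\<^bsub>free_alg S f e\<^esub> x = Poly_Mapping.map ((*) c) x"
  by (simp_all add: free_alg_def)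

lemma lookup_map_times [simp]:
  fixes c :: "'b::semiring_0"
  shows "Poly_Mapping.lookup (Poly_Mapping.map ((*) c) x) k = c * Poly_Mapping.lookup x k"
  by (simp add: Poly_Mapping.map.rep_eq when_def)

lemma keys_map_times_subset:
  fixes c :: "'b::semiring_0"
  shows "Poly_Mapping.keys (Poly_Mapping.map ((*) c) x) \<subseteq> Poly_Mapping.keys x"
  by (auto simp: in_keys_iff)

lemma map_times_add:
  fixes c :: "'b::semiring_0"
  shows "Poly_Mapping.map ((*) c) (x + y) = Poly_Mapping.map ((*) c) x + Poly_Mapping.map ((*) c) y"
  by (rule poly_mapping_eqI) (simp add: lookup_add distrib_left)

lemma map_times_uminus:
  fixes x :: "'a \<Rightarrow>\<^sub>0 'b::ring_1"
  shows "Poly_Mapping.map ((*) (- 1)) x = - x"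
  by (rule poly_mapping_eqI) simp

lemma map_times_single [simp]:
  fixes c :: "'b::semiring_0"
  shows "Poly_Mapping.map ((*) c) (Poly_Mapping.single p a) = Poly_Mapping.single p (c * a)"
  by (rule poly_mapping_eqI) (simp add: lookup_single when_def)

text \<open>Makes the range of summation independent of the support, so that the products for
  \<open>x\<close>, \<open>y\<close> and \<open>x + y\<close> can be compared term by term.\<close>

lemma free_alg_mult_superset:
  assumes "finite P" "Poly_Mapping.keys x \<subseteq> P" "finite Q" "Poly_Mapping.keys y \<subseteq> Q"
  shows "x \<otimes>\<^bsub>free_alg S f e\<^esub> y = (\<Sum>p\<in>P. \<Sum>q\<in>Q.
    Poly_Mapping.single (f p q) (Poly_Mapping.lookup x p * Poly_Mapping.lookup y q))"
proof -
  let ?t = "\<lambda>p q. Poly_Mapping.single (f p q) (Poly_Mapping.lookup x p * Poly_Mapping.lookup y q)"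
  have "(\<Sum>q\<in>Poly_Mapping.keys y. ?t p q) = (\<Sum>q\<in>Q. ?t p q)" for p
    using assms by (intro sum.mono_neutral_left) (auto simp: in_keys_iff)
  then show ?thesis
    using assms by (auto simp: free_alg_def in_keys_iff intro!: sum.mono_neutral_left)
qed

lemma free_alg_mult_add_left:
  "(x + y) \<otimes>\<^bsub>free_alg S f e\<^esub> z = x \<otimes>\<^bsub>free_alg S f e\<^esub> z + y \<otimes>\<^bsub>free_alg S f e\<^esub> z"
proof -
  let ?P = "Poly_Mapping.keys x \<union> Poly_Mapping.keys y" and ?Q = "Poly_Mapping.keys z"
  have "Poly_Mapping.keys (x + y) \<subseteq> ?P" by (rule Poly_Mapping.keys_add)
  then show ?thesis
    by (simp add: free_alg_mult_superset[where P = ?P and Q = ?Q] lookup_add distrib_right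
        single_add sum.distrib)
qed

lemma free_alg_mult_add_right:
  "z \<otimes>\<^bsub>free_alg S f e\<^esub> (x + y) = z \<otimes>\<^bsub>free_alg S f e\<^esub> x + z \<otimes>\<^bsub>free_alg S f e\<^esub> y"
proof -
  let ?P = "Poly_Mapping.keys x \<union> Poly_Mapping.keys y" and ?Q = "Poly_Mapping.keys z"
  have "Poly_Mapping.keys (x + y) \<subseteq> ?P" by (rule Poly_Mapping.keys_add)
  then show ?thesis
    by (simp add: free_alg_mult_superset[where P = ?Q and Q = ?P] lookup_add distrib_left
        single_add sum.distrib)
qed

lemma free_alg_mult_single [simp]:
  "Poly_Mapping.single p a \<otimes>\<^bsub>free_alg S f e\<^esub> Poly_Mapping.single q b =
    Poly_Mapping.single (f p q) (a * b)"
  by (subst free_alg_mult_superset[where P = "{p}" and Q = "{q}"]) auto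

lemma free_alg_mult_closed:
  assumes "\<And>p q. p \<in> S \<Longrightarrow> q \<in> S \<Longrightarrow> f p q \<in> S"
    "Poly_Mapping.keys x \<subseteq> S" "Poly_Mapping.keys y \<subseteq> S"
  shows "Poly_Mapping.keys (x \<otimes>\<^bsub>free_alg S f e\<^esub> y) \<subseteq> S"
proof -
  have "Poly_Mapping.keys (x \<otimes>\<^bsub>free_alg S f e\<^esub> y) \<subseteq>
     (\<Union>p\<in>Poly_Mapping.keys x. \<Union>q\<in>Poly_Mapping.keys y. {f p q})"
    unfolding free_alg_def monoid.simps
    by (intro order_trans[OF Poly_Mapping.keys_sum] UN_mono subset_refl) simp
  then show ?thesis using assms by blast
qed

text \<open>An ideal inside the carrier is closed under products of its own elements, which
  \<open>coset_mult\<close> asks for.\<close>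

lemma two_sided_ideal_subset:
  assumes "\<And>p q. p \<in> S \<Longrightarrow> q \<in> S \<Longrightarrow> f p q \<in> S"
    and "\<And>x. x \<in> R \<Longrightarrow> Poly_Mapping.keys x \<subseteq> S"
    and "x \<in> two_sided_ideal (free_alg S f e) R"
  shows "Poly_Mapping.keys x \<subseteq> S"
  using assms(3)
proof induction
  case (add x y)
  then show ?case using Poly_Mapping.keys_add[of x y] by auto
next
  case (smult x c)
  then show ?case using keys_map_times_subset[of c x] by auto
qed (use assms(1,2) free_alg_mult_closed[OF assms(1)] in auto)

lemma quot_alg_simps [simp]:
  "X \<otimes>\<^bsub>quot_alg A J\<^esub> Y = (\<Union>x\<in>X. \<Union>y\<in>Y. J +>\<^bsub>A\<^esub> (x \<otimes>\<^bsub>A\<^esub> y))"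
  "\<one>\<^bsub>quot_alg A J\<^esub> = J +>\<^bsub>A\<^esub> \<one>\<^bsub>A\<^esub>"
  "c \<odot>\<^bsub>quot_alg A J\<^esub> X = (\<Union>x\<in>X. J +>\<^bsub>A\<^esub> (c \<odot>\<^bsub>A\<^esub> x))"
  "carrier (quot_alg A J) = (\<lambda>x. J +>\<^bsub>A\<^esub> x) ` carrier A"
  by (auto simp: quot_alg_def FactRing_def rcoset_mult_def A_RCOSETS_def RCOSETS_def a_r_coset_def)

text \<open>Nothing is assumed about \<open>f\<close>, in particular not associativity, so these
  algebras are not known to be rings; coset arithmetic is derived from bilinearity and the closure
  rules of the ideal.\<close>

context
  fixes S :: "'a set" and f :: "'a \<Rightarrow> 'a \<Rightarrow> 'a" and e :: 'a
    and R J :: "('a \<Rightarrow>\<^sub>0 int poly) set" and A :: "(int poly, 'a \<Rightarrow>\<^sub>0 int poly) module"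
  defines "A \<equiv> free_alg S f e" and "J \<equiv> two_sided_ideal A R"
begin

lemma ideal_zero: "0 \<in> J"
  using two_sided_ideal.zero[of A R] by (simp add: A_def J_def)

lemma ideal_add: "x \<in> J \<Longrightarrow> y \<in> J \<Longrightarrow> x + y \<in> J"
  using two_sided_ideal.add[of x A R y] by (simp add: A_def J_def)

lemma ideal_smult: "x \<in> J \<Longrightarrow> Poly_Mapping.map ((*) c) x \<in> J"
  using two_sided_ideal.smult[of x A R c] by (simp add: A_def J_def)

lemma ideal_diff: "x \<in> J \<Longrightarrow> y \<in> J \<Longrightarrow> x - y \<in> J"
  using ideal_add[of x "- y"] ideal_smult[of y "- 1"] by (simp add: map_times_uminus)

lemma ideal_left: "x \<in> J \<Longrightarrow> r \<in> carrier A \<Longrightarrow> r \<otimes>\<^bsub>A\<^esub> x \<in> J"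
  and ideal_right: "x \<in> J \<Longrightarrow> r \<in> carrier A \<Longrightarrow> x \<otimes>\<^bsub>A\<^esub> r \<in> J"
  unfolding J_def by (fact two_sided_ideal.left two_sided_ideal.right)+

lemma in_coset_iff: "y \<in> J +>\<^bsub>A\<^esub> x \<longleftrightarrow> y - x \<in> J"
  unfolding A_def by (auto simp: a_r_coset_def r_coset_def) (metis diff_add_cancel)

lemma coset_eqI:
  assumes "x - y \<in> J"
  shows "J +>\<^bsub>A\<^esub> x = J +>\<^bsub>A\<^esub> y"
proof (rule Set.set_eqI)
  fix z
  show "z \<in> J +>\<^bsub>A\<^esub> x \<longleftrightarrow> z \<in> J +>\<^bsub>A\<^esub> y"
    using ideal_add[OF _ assms, of "z - x"] ideal_diff[OF _ assms, of "z - y"]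
    by (auto simp: in_coset_iff)
qed

lemma coset_smult: "c \<odot>\<^bsub>quot_alg A J\<^esub> (J +>\<^bsub>A\<^esub> x) = J +>\<^bsub>A\<^esub> (c \<odot>\<^bsub>A\<^esub> x)"
proof -
  have "J +>\<^bsub>A\<^esub> (c \<odot>\<^bsub>A\<^esub> y) = J +>\<^bsub>A\<^esub> (c \<odot>\<^bsub>A\<^esub> x)" if "y \<in> J +>\<^bsub>A\<^esub> x" for y
  proof (rule coset_eqI)
    have "Poly_Mapping.map ((*) c) (y - x) \<in> J"
      using that by (intro ideal_smult) (simp add: in_coset_iff)
    then show "(c \<odot>\<^bsub>A\<^esub> y) - (c \<odot>\<^bsub>A\<^esub> x) \<in> J"
      using map_times_add[of c "y - x" x] by (simp add: A_def)
  qed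
  moreover have "x \<in> J +>\<^bsub>A\<^esub> x" using ideal_zero by (simp add: in_coset_iff)
  ultimately show ?thesis unfolding quot_alg_simps by blast
qed

lemma mult_translates:
  "(a + x) \<otimes>\<^bsub>A\<^esub> (b + y) =
     a \<otimes>\<^bsub>A\<^esub> b + a \<otimes>\<^bsub>A\<^esub> y + x \<otimes>\<^bsub>A\<^esub> b + x \<otimes>\<^bsub>A\<^esub> y"
  unfolding A_def by (simp add: free_alg_mult_add_left free_alg_mult_add_right add_ac)

text \<open>In the expansion of (a + x)(b + y) the ideal rules cover the mixed terms but not a b,
  because an element of the ideal could lie outside the carrier; this product gets its own
  hypothesis.\<close>

lemma coset_mult:
  assumes J: "\<And>a b. a \<in> J \<Longrightarrow> b \<in> J \<Longrightarrow> a \<otimes>\<^bsub>A\<^esub> b \<in> J"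
    and x: "x \<in> carrier A" and y: "y \<in> carrier A"
  shows "(J +>\<^bsub>A\<^esub> x) \<otimes>\<^bsub>quot_alg A J\<^esub> (J +>\<^bsub>A\<^esub> y) = J +>\<^bsub>A\<^esub> (x \<otimes>\<^bsub>A\<^esub> y)"
proof -
  have "J +>\<^bsub>A\<^esub> (x' \<otimes>\<^bsub>A\<^esub> y') = J +>\<^bsub>A\<^esub> (x \<otimes>\<^bsub>A\<^esub> y)"
    if "x' \<in> J +>\<^bsub>A\<^esub> x" "y' \<in> J +>\<^bsub>A\<^esub> y" for x' y'
  proof (rule coset_eqI)
    define a b where "a = x' - x" and "b = y' - y"
    have "a \<in> J" "b \<in> J" using that by (simp_all add: a_def b_def in_coset_iff)
    then have "a \<otimes>\<^bsub>A\<^esub> b + a \<otimes>\<^bsub>A\<^esub> y + x \<otimes>\<^bsub>A\<^esub> b \<in> J"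
      using J[of a b] ideal_right[OF _ y, of a] ideal_left[OF _ x, of b]
      by (intro ideal_add)
    then show "x' \<otimes>\<^bsub>A\<^esub> y' - x \<otimes>\<^bsub>A\<^esub> y \<in> J"
      using mult_translates[of a x b y] by (simp add: a_def b_def)
  qed
  moreover have "x \<in> J +>\<^bsub>A\<^esub> x" "y \<in> J +>\<^bsub>A\<^esub> y"
    using ideal_zero by (simp_all add: in_coset_iff)
  ultimately show ?thesis unfolding quot_alg_simps by blast
qed

text \<open>If the coset of one element \<open>x\<close> has a product with itself that is contained in a single
  coset, then the expansion of \<open>(a + x)(b + x)\<close> shows that \<open>ab\<close> lies in the ideal.\<close>

lemma ideal_mult_closed_if_square_coset:
  assumes x: "x \<in> carrier A"
    and sq: "(J +>\<^bsub>A\<^esub> x) \<otimes>\<^bsub>quot_alg A J\<^esub> (J +>\<^bsub>A\<^esub> x) = J +>\<^bsub>A\<^esub> z"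
    and a: "a \<in> J" and b: "b \<in> J"
  shows "a \<otimes>\<^bsub>A\<^esub> b \<in> J"
proof -
  have "(c + x) \<otimes>\<^bsub>A\<^esub> (d + x) - z \<in> J" if "c \<in> J" "d \<in> J" for c d
  proof -
    have "(c + x) \<otimes>\<^bsub>A\<^esub> (d + x) \<in> J +>\<^bsub>A\<^esub> ((c + x) \<otimes>\<^bsub>A\<^esub> (d + x))"
      "c + x \<in> J +>\<^bsub>A\<^esub> x" "d + x \<in> J +>\<^bsub>A\<^esub> x"
      using ideal_zero that by (simp_all add: in_coset_iff)
    then have "(c + x) \<otimes>\<^bsub>A\<^esub> (d + x) \<in> J +>\<^bsub>A\<^esub> z"
      unfolding sq[symmetric] quot_alg_simps by blast
    then show ?thesis by (simp add: in_coset_iff)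
  qed
  \<comment> \<open>The instance with both translates zero removes x x and z; the mixed terms are
    then subtracted as elements of the ideal.\<close>
  from ideal_diff[OF this[OF a b] this[OF ideal_zero ideal_zero]]
  have "a \<otimes>\<^bsub>A\<^esub> b + a \<otimes>\<^bsub>A\<^esub> x + x \<otimes>\<^bsub>A\<^esub> b \<in> J"
    by (simp add: mult_translates)
  from ideal_diff[OF this ideal_add[OF ideal_right[OF a x] ideal_left[OF b x]]]
  show ?thesis by (simp add: algebra_simps)
qed

end



section \<open>Words in the Temperley-Lieb algebra\<close>

lemma keys_single_subset: "p \<in> S \<Longrightarrow> Poly_Mapping.keys (Poly_Mapping.single p a) \<subseteq> S"
  by simp

lemma keys_diff_subset:
  fixes x :: "'a \<Rightarrow>\<^sub>0 int poly"
  assumes "Poly_Mapping.keys x \<subseteq> S" "Poly_Mapping.keys y \<subseteq> S"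
  shows "Poly_Mapping.keys (x - y) \<subseteq> S"
  using assms Poly_Mapping.keys_diff[of x y] by blast

lemma TL_rels_subset:
  assumes "n \<ge> 2" "x \<in> TL_rels n"
  shows "Poly_Mapping.keys x \<subseteq> lists {1..n + 1}"
proof -
  have "\<exists>p q a b. p \<in> lists {1..n + 1} \<and> q \<in> lists {1..n + 1} \<and>
      x = Poly_Mapping.single p a - Poly_Mapping.single q b"
    using assms(2) unfolding TL_rels_def
  proof (elim UnE)
    assume "x \<in> {Poly_Mapping.single [i, j, i, j] 1 - Poly_Mapping.single [i, j] 2 | i j.
        {i, j} = {1, 2} \<or> {i, j} = {n, n + 1}}"
    then obtain i j where x: "x = Poly_Mapping.single [i, j, i, j] 1 - Poly_Mapping.single [i, j] 2"
      and "{i, j} = {1, 2} \<or> {i, j} = {n, n + 1}" by blast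
    then have "i \<in> {1..n + 1}" "j \<in> {1..n + 1}" using assms(1) by (auto simp: doubleton_eq_iff)
    with x show ?thesis by (intro exI[of _ "[i, j, i, j]"] exI[of _ "[i, j]"]) auto
  next
    assume "x \<in> {Poly_Mapping.single [i, i] 1 - Poly_Mapping.single [i] delta | i. i \<in> {1..n + 1}}"
    then obtain i where "i \<in> {1..n + 1}"
      "x = Poly_Mapping.single [i, i] 1 - Poly_Mapping.single [i] delta"
      by blast
    then show ?thesis by (intro exI[of _ "[i, i]"] exI[of _ "[i]"]) auto
  next
    assume "x \<in> {Poly_Mapping.single [i, j] 1 - Poly_Mapping.single [j, i] 1 | i j.
        i \<in> {1..n + 1} \<and> j \<in> {1..n + 1} \<and> \<bar>int i - int j\<bar> > 1}"
    then obtain i j where "i \<in> {1..n + 1}" "j \<in> {1..n + 1}"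
      "x = Poly_Mapping.single [i, j] 1 - Poly_Mapping.single [j, i] 1" by blast
    then show ?thesis by (intro exI[of _ "[i, j]"] exI[of _ "[j, i]"]) auto
  next
    assume "x \<in> {Poly_Mapping.single [i, j, i] 1 - Poly_Mapping.single [i] 1 | i j.
        i \<in> {2..n} \<and> j \<in> {2..n} \<and> \<bar>int i - int j\<bar> = 1}"
    then obtain i j where "i \<in> {2..n}" "j \<in> {2..n}"
      "x = Poly_Mapping.single [i, j, i] 1 - Poly_Mapping.single [i] 1" by blast
    then show ?thesis by (intro exI[of _ "[i, j, i]"] exI[of _ "[i]"]) auto
  qed
  then show ?thesis using keys_diff_subset keys_single_subset by metis
qed

definition TL_word :: "nat \<Rightarrow> nat list \<Rightarrow> (nat list \<Rightarrow>\<^sub>0 int poly) set" where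
  "TL_word n a = TL_ideal n +>\<^bsub>free_TL n\<^esub> Poly_Mapping.single a 1"

lemma TL_coset_mult:
  assumes "n \<ge> 2" "x \<in> carrier (free_TL n)" "y \<in> carrier (free_TL n)"
  shows "(TL_ideal n +>\<^bsub>free_TL n\<^esub> x) \<otimes>\<^bsub>TL n\<^esub> (TL_ideal n +>\<^bsub>free_TL n\<^esub> y) =
    TL_ideal n +>\<^bsub>free_TL n\<^esub> (x \<otimes>\<^bsub>free_TL n\<^esub> y)"
proof -
  have sub: "Poly_Mapping.keys x \<subseteq> lists {1..n + 1}"
    if "x \<in> two_sided_ideal (free_alg (lists {1..n + 1}) (@) []) (TL_rels n)" for x
    by (rule two_sided_ideal_subset[OF _ TL_rels_subset[OF assms(1)] that]) auto
  show ?thesis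
    using assms(2,3) sub unfolding TL_def TL_ideal_def free_TL_def
    by (intro coset_mult ideal_right) (simp_all del: atLeastAtMost_iff)
qed

lemma TL_word_mult:
  assumes "n \<ge> 2" "a \<in> lists {1..n + 1}" "b \<in> lists {1..n + 1}"
  shows "TL_word n a \<otimes>\<^bsub>TL n\<^esub> TL_word n b = TL_word n (a @ b)"
  unfolding TL_word_def using assms
  by (subst TL_coset_mult) (auto simp: free_TL_def)

lemma TL_word_in_carrier: "a \<in> lists {1..n + 1} \<Longrightarrow> TL_word n a \<in> carrier (TL n)"
  unfolding TL_word_def TL_def quot_alg_simps by (rule imageI) (simp add: free_TL_def)

text \<open>Under \<theta> this turns the square of a generating diagram into a scalar multiple of
  it, hence into one coset.\<close>

lemma b_gen_square:
  assumes "n \<ge> 2" "i \<in> {1..n + 1}"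
  shows "b_gen n i \<otimes>\<^bsub>TL n\<^esub> b_gen n i = delta \<odot>\<^bsub>TL n\<^esub> b_gen n i"
proof -
  have "Poly_Mapping.single [i, i] 1 - Poly_Mapping.single [i] delta \<in> TL_ideal n"
    unfolding TL_ideal_def using assms by (intro two_sided_ideal.base) (auto simp: TL_rels_def)
  then have "TL_word n [i, i] = TL_ideal n +>\<^bsub>free_TL n\<^esub> Poly_Mapping.single [i] delta"
    unfolding TL_word_def TL_ideal_def free_TL_def by (rule coset_eqI)
  also have "\<dots> = delta \<odot>\<^bsub>TL n\<^esub> b_gen n i"
    unfolding b_gen_def TL_def TL_ideal_def free_TL_def coset_smult by simp
  finally show ?thesis
    using TL_word_mult[of n "[i]" "[i]"] assms by (simp add: TL_word_def b_gen_def)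
qed

lemma b_elt_product:
  assumes "n \<ge> 2" "set a \<subseteq> {1..n + 1}"
  shows "foldr (\<lambda>i x. b_gen n i \<otimes>\<^bsub>TL n\<^esub> x) a \<one>\<^bsub>TL n\<^esub> = TL_word n a"
  using assms(2)
proof (induction a)
  case Nil
  then show ?case by (simp add: TL_def TL_word_def free_TL_def)
next
  case (Cons i a)
  then show ?case
    using TL_word_mult[of n "[i]" a] assms(1)
    by (simp add: TL_word_def b_gen_def in_lists_conv_set subset_iff)
qed

lemma simple_diag_dot: "i \<in> {1..n + 1} \<Longrightarrow>
    simple_diag n i (if i = 1 then [Bdot] else if i = n + 1 then [Wdot] else []) =
    one_cup n i i (dot n i) (dot n i) (map (tag n i) [])"
  by (subst simple_diag_one_cup) (auto simp: dot_def)

section \<open>Consequences of the existence of the morphism \<theta>\<close>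

context
  fixes n :: nat and \<theta>
  assumes n: "n \<ge> 2" and \<theta>: "is_theta n \<theta>"
begin

lemma theta_simps:
  "x \<in> carrier (TL n) \<Longrightarrow> y \<in> carrier (TL n) \<Longrightarrow> \<theta> (x \<otimes>\<^bsub>TL n\<^esub> y) = \<theta> x \<otimes>\<^bsub>diag_alg n\<^esub> \<theta> y"
  "x \<in> carrier (TL n) \<Longrightarrow> \<theta> (c \<odot>\<^bsub>TL n\<^esub> x) = c \<odot>\<^bsub>diag_alg n\<^esub> \<theta> x"
  "i \<in> {1..n + 1} \<Longrightarrow> \<theta> (b_gen n i) = d_gen n i"
  using \<theta> by (auto simp: is_theta_def alg_hom_def ring_hom_def DC_def)

lemma single_in_free_diag_alg:
  "D \<in> ddiagrams n \<Longrightarrow> Poly_Mapping.single D a \<in> carrier (free_diag_alg n)"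
  by (simp add: free_diag_alg_def)

text \<open>The product of two cosets need not be a coset a priori, as it is not known that \<open>conc\<close> maps
  into \<open>ddiagrams n\<close>.  The existence of \<open>\<theta>\<close> forces it to be one for the square of a generator,
  which is enough.\<close>

lemma diag_ideal_mult_closed:
  assumes "x \<in> diag_ideal n" "y \<in> diag_ideal n"
  shows "x \<otimes>\<^bsub>free_diag_alg n\<^esub> y \<in> diag_ideal n"
proof -
  have b: "b_gen n 1 \<in> carrier (TL n)"
    using TL_word_in_carrier[of "[1]" n] by (simp add: TL_word_def b_gen_def)
  let ?D = "one_cup n 1 1 (dot n 1) (dot n 1) (map (tag n 1) [])"
  have D: "?D \<in> ddiagrams n"
    by (rule one_cup_in_ddiagrams) (use n in auto)
  have d: "d_gen n 1 = diag_class n ?D"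
    unfolding d_gen_def using simple_diag_dot[of 1 n] by simp
  have "d_gen n 1 \<otimes>\<^bsub>diag_alg n\<^esub> d_gen n 1 = delta \<odot>\<^bsub>diag_alg n\<^esub> d_gen n 1"
    using theta_simps(1)[OF b b] theta_simps(2)[OF b, of delta] theta_simps(3)[of 1]
      b_gen_square[OF n, of 1] by simp
  then show ?thesis
    using assms single_in_free_diag_alg[OF D, of 1]
    unfolding d diag_class_def diag_ideal_def free_diag_alg_def diag_alg_def coset_smult
    by (intro ideal_mult_closed_if_square_coset)
qed

lemma diag_class_mult:
  assumes "D \<in> ddiagrams n" "D' \<in> ddiagrams n"
  shows "diag_class n D \<otimes>\<^bsub>diag_alg n\<^esub> diag_class n D' = diag_class n (conc D D')"
  using diag_ideal_mult_closed single_in_free_diag_alg[OF assms(1)]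
    single_in_free_diag_alg[OF assms(2)]
  unfolding diag_class_def diag_alg_def diag_ideal_def free_diag_alg_def
  by (subst coset_mult) (simp_all add: assms)

end

lemma diag_class_eq_if_diag_rel:
  assumes "D \<in> ddiagrams n" "D' \<in> ddiagrams n" "diag_rel D 1 D'"
  shows "diag_class n D = diag_class n D'"
  unfolding diag_class_def diag_ideal_def free_diag_alg_def
  by (rule coset_eqI, rule two_sided_ideal.base) (use assms in blast)

section \<open>Words in Coxeter groups\<close>

lemma cox_eq_lists: "cox_eq I m u v \<Longrightarrow> u \<in> lists I \<and> v \<in> lists I"
  by (induction rule: cox_eq.induct) (auto split: if_splits)

lemma equiv_cox_eq: "equiv (lists I) {(u, v). cox_eq I m u v}"
  by (rule equivI)
    (auto simp: refl_on_def sym_def trans_def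
      dest: cox_eq_lists intro: cox_eq.refl cox_eq.sym cox_eq.trans)

lemma cox_group_closed:
  assumes "w \<in> cox_group I m" "a \<in> w"
  shows "b \<in> w \<longleftrightarrow> cox_eq I m a b"
proof -
  obtain x where w: "w = {b. cox_eq I m x b}"
    using assms(1) by (auto simp: cox_group_def elim!: quotientE)
  then show ?thesis using assms(2) by (auto intro: cox_eq.sym cox_eq.trans)
qed

lemma cox_group_lists: "w \<in> cox_group I m \<Longrightarrow> a \<in> w \<Longrightarrow> a \<in> lists I"
  using cox_group_closed cox_eq_lists by blast

lemma reduced_exprs_nonempty:
  assumes "w \<in> cox_group I m"
  shows "reduced_exprs w \<noteq> {}"
proof -
  have "w \<noteq> {}"
    using assms in_quotient_imp_non_empty[OF equiv_cox_eq] unfolding cox_group_def by blast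
  then have "\<exists>a\<in>w. \<forall>b\<in>w. length a \<le> length b"
    using ex_has_least_nat[of "\<lambda>a. a \<in> w" _ length] by blast
  then show ?thesis by (auto simp: reduced_exprs_def)
qed

lemma reduced_expr_in: "reduced_exprs w \<noteq> {} \<Longrightarrow> reduced_expr w \<in> reduced_exprs w"
  unfolding reduced_expr_def by (rule someI_ex) blast

lemma not_successively_neq:
  assumes "\<not> successively (\<noteq>) xs"
  shows "\<exists>ps s ss. xs = ps @ [s, s] @ ss"
  using assms
proof (induction xs rule: induct_list012)
  case (3 x y zs)
  show ?case
  proof (cases "x = y")
    case True
    then show ?thesis by (intro exI[of _ "[]"]) simp
  next
    case False
    then obtain ps s ss where "y # zs = ps @ [s, s] @ ss" using 3 by auto
    then show ?thesis by (intro exI[of _ "x # ps"]) simp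
  qed
qed auto

text \<open>The relation for s = t says that s s is trivial, so a repeated letter could be
  cancelled. It is applied to the element chosen by \<open>tau\<close>, about whose word little else
  is known.\<close>

lemma reduced_no_repetition:
  assumes "w \<in> cox_group I m" "\<And>s. m s s = 1" "a \<in> reduced_exprs w"
  shows "successively (\<noteq>) a"
proof (rule ccontr)
  assume "\<not> successively (\<noteq>) a"
  then obtain ps s ss where a: "a = ps @ [s, s] @ ss"
    using not_successively_neq by blast
  have aw: "a \<in> w" and min: "\<And>b. b \<in> w \<Longrightarrow> length a \<le> length b"
    using assms(3) by (auto simp: reduced_exprs_def)
  have "a \<in> lists I" using cox_group_lists[OF assms(1) aw] .
  then have "cox_eq I m (ps @ concat (replicate (m s s) [s, s]) @ ss) (ps @ ss)"
    unfolding a by (intro cox_eq.rel) auto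
  then have "ps @ ss \<in> w"
    using cox_group_closed[OF assms(1) aw] assms(2) by (simp add: a)
  from min[OF this] show False by (simp add: a)
qed

section \<open>Monotone words in type A\<close>

text \<open>The standard map to permutations, an invariant of group elements that bounds all words
  for an element at once.\<close>

definition perm_of :: "nat list \<Rightarrow> nat \<Rightarrow> nat" where
  "perm_of = foldr (\<lambda>i. transpose i (Suc i))"

lemma perm_of_simps [simp]:
  "perm_of [] x = x" "perm_of (i # a) x = transpose i (Suc i) (perm_of a x)"
  "perm_of (a @ b) x = perm_of a (perm_of b x)"
  by (simp_all add: perm_of_def)

lemma perm_of_cox_eq:
  assumes "cox_eq I mA a b"
  shows "perm_of a x = perm_of b x"
  using assms
proof (induction arbitrary: x)
  case (rel u v s t)
  \<comment> \<open>The exponent is 1, 2 or 3, so at most six transpositions have to be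
    evaluated.\<close>
  have "perm_of (concat (replicate (mA s t) [s, t])) y = y" for y
    by (auto simp: mA_def numeral_3_eq_3 numeral_2_eq_2 transpose_def)
  then show ?case by simp
qed auto

text \<open>A letter moves a point by at most one, so a word that moves \<open>x\<close> to \<open>y\<close> contains all letters
  in between, in this order.\<close>

lemma subseq_upt_perm_of:
  assumes "perm_of a x \<le> x"
  shows "subseq [perm_of a x..<x] a"
  using assms
proof (induction a)
  case (Cons c a)
  \<comment> \<open>\<open>y\<close> is the image of \<open>x\<close> under the tail; the three
    cases are that the letter \<open>c\<close> moves it up, moves it down or fixes it.\<close>
  define y where "y = perm_of a x"
  consider "y = c" | "y = Suc c" | "y \<noteq> c" "y \<noteq> Suc c" by blast
  then show ?case
  proof cases
    case 1
    then have "subseq [y..<x] a" "y < x" using Cons by (simp_all add: y_def)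
    then have "subseq [Suc y..<x] a"
      by (metis subseq_Cons' upt_conv_Cons)
    then show ?thesis using 1 by (simp add: y_def list_emb_Cons)
  next
    case 2
    show ?thesis
    proof (cases "y \<le> x")
      case True
      then have "subseq (c # [Suc c..<x]) (c # a)" using Cons.IH 2 by (simp add: y_def)
      then show ?thesis using 2 True by (simp add: y_def upt_conv_Cons)
    next
      case False
      then show ?thesis using 2 Cons.prems by (simp add: y_def)
    qed
  next
    case 3
    then show ?thesis using Cons by (simp add: y_def transpose_def list_emb_Cons)
  qed
qed simp

lemma subseq_rev_upt_perm_of:
  assumes "x \<le> perm_of a x"
  shows "subseq (rev [x..<perm_of a x]) a"
  using assms
proof (induction a)
  case (Cons c a)
  define y where "y = perm_of a x"
  consider "y = c" | "y = Suc c" | "y \<noteq> c" "y \<noteq> Suc c" by blast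
  then show ?case
  proof cases
    case 1
    show ?thesis
    proof (cases "x \<le> y")
      case True
      then have "subseq (c # rev [x..<c]) (c # a)" using Cons.IH 1 by (simp add: y_def)
      then show ?thesis using 1 True by (simp add: y_def)
    next
      case False
      then show ?thesis using 1 Cons.prems by (simp add: y_def)
    qed
  next
    case 2
    then have "subseq (rev [x..<Suc c]) a" "x \<le> c" using Cons by (simp_all add: y_def)
    then have "subseq (rev [x..<c]) a"
      by (simp add: subseq_Cons')
    then show ?thesis using 2 by (simp add: y_def list_emb_Cons)
  next
    case 3
    then show ?thesis using Cons by (simp add: y_def transpose_def list_emb_Cons)
  qed
qed simp

text \<open>The shortest walk from \<open>p\<close> to \<open>q\<close>; as a word in type A its
  diagram has its cup at \<open>p\<close> and its cap at \<open>q\<close>.\<close>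

definition run :: "nat \<Rightarrow> nat \<Rightarrow> nat list" where
  "run p q = (if p \<le> q then [p..<Suc q] else rev [q..<Suc p])"

lemma perm_of_upt: "p \<le> q \<Longrightarrow> perm_of [p..<q] q = p"
  by (induction q rule: dec_induct) auto

lemma perm_of_rev_upt: "q \<le> p \<Longrightarrow> perm_of (rev [q..<p]) q = p"
  by (induction p rule: dec_induct) auto

text \<open>One point, \<open>Suc q\<close> or \<open>q\<close>, is carried along by every letter of
  the run. An equivalent word must carry it equally far.\<close>

lemma subseq_run:
  assumes "cox_eq I mA (run p q) a"
  shows "subseq (run p q) a"
proof (cases "p \<le> q")
  case True
  then have "perm_of a (Suc q) = p"
    using perm_of_cox_eq[OF assms, of "Suc q"] perm_of_upt[of p "Suc q"] by (simp add: run_def)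
  then show ?thesis using subseq_upt_perm_of[of a "Suc q"] True by (simp add: run_def)
next
  case False
  then have "perm_of a q = Suc p"
    using perm_of_cox_eq[OF assms, of q] perm_of_rev_upt[of q "Suc p"] by (simp add: run_def)
  then show ?thesis using subseq_rev_upt_perm_of[of q a] False by (simp add: run_def)
qed

lemma successively_adjacent_upt: "successively adjacent [p..<q]"
  by (induction q) (auto simp: successively_append_iff adjacent_def)

lemma adjacent_commute: "adjacent i j \<longleftrightarrow> adjacent j i"
  by (auto simp: adjacent_def)

lemma successively_adjacent_rev: "successively adjacent (rev a) \<longleftrightarrow> successively adjacent a"
  unfolding successively_rev by (rule successively_cong) (simp_all add: adjacent_commute)

lemma lattice_path_run:
  assumes "p \<in> {1..n + 1}" "q \<in> {1..n + 1}"
  shows "lattice_path n (run p q)" "hd (run p q) = p" "last (run p q) = q"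
proof -
  have "successively adjacent (run p q)"
    using successively_adjacent_upt
    by (simp add: run_def successively_adjacent_rev del: upt_Suc successively_rev)
  then show "lattice_path n (run p q)"
    using assms by (auto simp: lattice_path_def run_def)
  show "hd (run p q) = p" "last (run p q) = q"
    by (auto simp: run_def hd_append last_rev)
qed

text \<open>A word that contains the run as a subsequence is at least as long, and equally long only
  if it is the run. With a single reduced expression, full commutativity is immediate.\<close>

lemma ex_FC_A_reduced_exprs_run:
  assumes "p \<in> {1..n + 1}" "q \<in> {1..n + 1}"
  shows "\<exists>u\<in>FC_A n. reduced_exprs u = {run p q}"
proof -
  define u where "u = {a. cox_eq {1..n + 1} mA (run p q) a}"
  have run: "run p q \<in> lists {1..n + 1}"
    using lattice_path_run(1)[OF assms] by (auto simp: lattice_path_def)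
  have u: "u \<in> cox_group {1..n + 1} mA"
    unfolding cox_group_def quotient_def u_def using run by blast
  have run_u: "run p q \<in> u" unfolding u_def using run by (simp add: cox_eq.refl)
  have sub: "subseq (run p q) a" if "a \<in> u" for a
    using that subseq_run by (simp add: u_def)
  have "reduced_exprs u = {run p q}"
  proof (intro equalityI subsetI)
    fix a assume "a \<in> reduced_exprs u"
    then have "a \<in> u" "length a \<le> length (run p q)"
      using run_u by (auto simp: reduced_exprs_def)
    then show "a \<in> {run p q}"
      using sub[of a] list_emb_length[OF sub[of a]] subseq_same_length[of "run p q" a] by simp
  qed (use run_u list_emb_length[OF sub] in \<open>auto simp: reduced_exprs_def\<close>)
  with u show ?thesis
    by (intro bexI[of _ u]) (auto simp: FC_A_def FC_def)
qed

text \<open>A monotone word shows that the choice in \<open>tau\<close> has a candidate. For the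
  element actually chosen, the defining equation fixes \<open>arcs\<close> and \<open>vert\<close>;
  its loops are excluded by showing that its reduced word has unit steps, since a second cap would
  be visible in \<open>arcs\<close>.\<close>

lemma d_elt_tau:
  assumes n: "n \<ge> 2" and a: "lattice_path n a" and w: "reduced_expr w = a"
  shows "d_elt n (tau n w) = one_cup n (hd a) (last a) [] [] []"
proof -
  let ?P = "\<lambda>u. u \<in> FC_A n \<and> (\<exists>\<alpha>. diag_prod n (reduced_expr w)
     = (d_elt n u)\<lparr>loops := replicate_mset \<alpha> (cyc [])\<rparr>)"
  have w': "diag_prod n (reduced_expr w) = one_cup n (hd a) (last a) [] [] []"
    using diag_prod_lattice_path[OF n a] w by simp
  note ha = lattice_path_ends[OF a]
  obtain u where u: "u \<in> FC_A n" "reduced_exprs u = {run (hd a) (last a)}"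
    using ex_FC_A_reduced_exprs_run[OF ha] by blast
  then have "reduced_expr u = run (hd a) (last a)"
    using reduced_expr_in[of u] by simp
  then have "d_elt n u = one_cup n (hd a) (last a) [] [] []"
    unfolding d_elt_def using diag_prod_lattice_path[OF n] lattice_path_run[OF ha] by simp
  then have "?P u"
    using u(1) unfolding w' by (auto simp: one_cup_def intro!: exI[of _ 0])
  then have P: "?P (tau n w)"
    unfolding tau_def by (rule someI)
  define b where "b = reduced_expr (tau n w)"
  have arcs: "arcs (d_elt n (tau n w)) = arcs (one_cup n (hd a) (last a) [] [] [])"
    and vert: "vert (d_elt n (tau n w)) = []"
    using P unfolding w'
    by (metis ddiag.select_convs ddiag.update_convs(3) ddiag.surjective one_cup_simps(1))+
  have grp: "tau n w \<in> cox_group {1..n + 1} mA"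
    using P by (auto simp: FC_A_def FC_def)
  have b: "b \<in> reduced_exprs (tau n w)"
    unfolding b_def using reduced_exprs_nonempty[OF grp] by (rule reduced_expr_in)
  then have "set b \<subseteq> {1..n + 1}" "successively (\<noteq>) b"
    using cox_group_lists[OF grp] reduced_no_repetition[OF grp _ b]
    by (auto simp: reduced_exprs_def mA_def)
  \<comment> \<open>The empty word would give the identity, which has no edge between north
    nodes.\<close>
  moreover have "b \<noteq> []"
  proof
    assume "b = []"
    then have "d_elt n (tau n w) = id_diag n"
      by (simp add: d_elt_def b_def diag_prod_def)
    moreover have "(North (hd a), [], North (hd a + 1)) \<in> arcs (one_cup n (hd a) (last a) [] [] [])"
      using ha by (auto simp: arcs_one_cup)
    ultimately have "(North (hd a), [], North (hd a + 1)) \<in> arcs (id_diag n)"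
      using arcs by simp
    then show False by (simp add: arcs_id_diag)
  qed
  moreover have "\<not> two_caps (diag_prod n b)"
    using not_two_caps_one_cup[OF arcs] by (simp add: d_elt_def b_def)
  ultimately have "lattice_path n b"
    using lattice_path_or_two_caps[OF n] by blast
  then have "loops (d_elt n (tau n w)) = {#}"
    using diag_prod_lattice_path[OF n] by (simp add: d_elt_def b_def)
  then show ?thesis
    using arcs vert by (simp add: one_cup_def)
qed

section \<open>Reduced expressions of zigzags\<close>

lemma successively_sublist: "sublist a b \<Longrightarrow> successively P b \<Longrightarrow> successively P a"
  by (auto simp: sublist_def successively_append_iff)

lemma zigzag_successively_adjacent:
  assumes "n \<ge> 2" "zigzag_factor n a"
  shows "successively adjacent a"
proof -
  define z where "z = [1..<n + 2] @ rev [2..<n + 1]"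
  \<comment> \<open>For n \<ge> 2 the descending half of the period is non-empty and ends in 2, so
    the next period continues with the adjacent letter 1.\<close>
  have "[2..<n + 1] = 2 # [3..<n + 1]"
    using assms(1) by (simp add: upt_conv_Cons eval_nat_numeral)
  then have z: "z \<noteq> []" "hd z = 1" "last z = 2"
    by (simp_all add: z_def hd_append upt_conv_Cons)
  have "adjacent (last [1..<n + 2]) (hd (rev [2..<n + 1]))"
    using assms(1) by (simp add: hd_rev adjacent_def)
  then have adj: "successively adjacent z"
    unfolding z_def successively_append_iff successively_adjacent_rev
    using successively_adjacent_upt by blast
  have hd: "concat (replicate k z) \<noteq> [] \<Longrightarrow> hd (concat (replicate k z)) = 1" for k
    using z by (cases k) auto
  have "successively adjacent (concat (replicate k z))" for k
    by (induction k) (use adj z hd in \<open>auto simp: successively_append_iff adjacent_def\<close>)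
  then show ?thesis
    using assms(2) successively_sublist unfolding zigzag_factor_def z_def by blast
qed

lemma not_comm_step_successively_adjacent:
  assumes "successively adjacent a"
  shows "\<not> comm_step (mC n) a b"
proof
  assume "comm_step (mC n) a b"
  then obtain u v s t where "mC n s t = 2" "a = u @ [s, t] @ v"
    unfolding comm_step_def by blast
  with assms show False
    by (auto simp: successively_append_iff adjacent_def mC_def split: if_splits)
qed

lemma reduced_exprs_zigzag:
  assumes "w \<in> FC_C n" "a \<in> reduced_exprs w" "successively adjacent a"
  shows "reduced_exprs w = {a}"
proof -
  have "b = a" if "b \<in> reduced_exprs w" for b
  proof -
    have "(comm_step (mC n))\<^sup>*\<^sup>* a b"
      using assms(1,2) that by (auto simp: FC_C_def FC_def)
    then show ?thesis
      using not_comm_step_successively_adjacent[OF assms(3)] by (metis converse_rtranclpE)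
  qed
  with assms(2) show ?thesis by blast
qed

lemma zigzag_reduced_expr:
  assumes "n \<ge> 2" "w \<in> FC_C n" "ZZ n w \<or> PZZ n w"
  obtains a where "reduced_expr w = a" "zigzag_expr n w = a" "lattice_path n a" "length a \<ge> 2"
proof -
  obtain a where a: "a \<in> reduced_exprs w" "zigzag_factor n a"
    and "(\<exists>i. count_list a i \<ge> 3) \<or> sublist [2, 1, 2] a"
    using assms(3) unfolding ZZ_def PZZ_def by blast
  \<comment> \<open>From three occurrences of one letter, or from the factor 2 1 2. Length at least
    two separates the first letter from the last one, so that \<open>decZ\<close> changes two
    different entries for them.\<close>
  then have "3 \<le> length a"
    using order_trans[OF _ count_le_length[of a]] sublist_length_le[of "[2, 1, 2]" a] by auto
  then have len: "length a \<ge> 2" by simp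
  have adj: "successively adjacent a"
    using zigzag_successively_adjacent[OF assms(1) a(2)] .
  have red: "reduced_exprs w = {a}"
    using reduced_exprs_zigzag[OF assms(2) a(1) adj] .
  have "a \<in> lists {1..n + 1}"
    using assms(2) a(1) cox_group_lists unfolding FC_C_def FC_def reduced_exprs_def by blast
  then have "lattice_path n a"
    using len adj by (auto simp: lattice_path_def)
  moreover have "reduced_expr w = a"
    using reduced_expr_in[of w] red by simp
  moreover have "zigzag_expr n w = a"
    unfolding zigzag_expr_def red using a(2) by (intro some_equality) auto
  ultimately show thesis using that len by blast
qed

section \<open>Decorated diagrams of zigzags\<close>

text \<open>The relation \<open>block\<close> changes an edge word and \<open>vert\<close> side by
  side; in \<open>one_cup\<close> the words are read off from \<open>vert\<close>, so both changes
  amount to a new \<open>vs\<close>.\<close>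

lemma replace_word_one_cup:
  assumes "\<And>k. k \<noteq> f \<Longrightarrow> beads k vs' = beads k vs" "f \<noteq> p" "f \<noteq> p + 1"
  shows "(replace_word (North f) (beads f vs') (link p r (North f))
      (one_cup n p r u v vs))\<lparr>vert := vs'\<rparr>
    = one_cup n p r u v vs'"
proof -
  let ?y = "link p r (North f)"
  have "(if x = North f \<and> link p r x = ?y then beads f vs'
      else if x = ?y \<and> link p r x = North f then rev (beads f vs')
      else link_word p r u v vs x) = link_word p r u v vs' x" for x
  proof (cases x)
    case (North k)
    then show ?thesis using assms by (cases "k = f") auto
  next
    case (South k)
    show ?thesis
    proof (cases "k = r \<or> k = r + 1 \<or> skip p (unskip r k) \<noteq> f")
      case True
      then show ?thesis using South assms(1) by auto
    next
      case False
      then have "link p r x = North f" "link_word p r u v vs' x = rev (beads f vs')"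
        using South by auto
      then show ?thesis using South link_link[of p r x] by simp
    qed
  qed
  then show ?thesis
    by (simp add: replace_word_def one_cup_def image_image del: link.simps)
qed

lemma diag_class_merge:
  assumes n: "n \<ge> 2" and p: "p \<in> {1..n + 1}" and r: "r \<in> {1..n + 1}"
    and rel: "deco_rel [c, c] 1 [t]"
  shows "diag_class n (one_cup n p r (dot n p) (dot n r) (map (tag n p) (c # c # ds))) =
    diag_class n (one_cup n p r (dot n p) (dot n r) (map (tag n p) (t # ds)))"
proof (rule diag_class_eq_if_diag_rel)
  define f where "f = fst (tag n p c)"
  have f: "f \<in> {1..n + 2}" "f \<noteq> p" "f \<noteq> p + 1"
    using fst_tag[OF n p, of c] by (auto simp: f_def)
  \<comment> \<open>The relation forces \<open>c\<close> and \<open>t\<close> to have the same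
    colour, hence the same edge.\<close>
  have tag: "tag n p c = (f, c)" "tag n p t = (f, t)"
    using rel by (auto simp: f_def tag_def elim: deco_rel.cases)
  let ?D = "one_cup n p r (dot n p) (dot n r) (map (tag n p) (c # c # ds))"
  let ?vs = "map (tag n p) (t # ds)"
  obtain s where s: "link p r (North f) = South s"
    using f by simp
  have "(North f, link_word p r (dot n p) (dot n r) (map (tag n p) (c # c # ds)) (North f), South s)
      \<in> arcs ?D"
    using f s by (simp add: arcs_one_cup)
  then have "diag_rel ?D 1 ((replace_word (North f) (beads f ?vs) (South s) ?D)\<lparr>vert := ?vs\<rparr>)"
    using tag
    by (intro diag_rel.block[OF rel a_val_one_cup[OF p],
          where us = "[]" and i = f and vs = "map (tag n p) ds"]) auto
  also have "(replace_word (North f) (beads f ?vs) (South s) ?D)\<lparr>vert := ?vs\<rparr>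
      = one_cup n p r (dot n p) (dot n r) ?vs"
    unfolding s[symmetric] using f tag by (intro replace_word_one_cup) (auto simp: beads_def)
  finally show "diag_rel ?D 1 (one_cup n p r (dot n p) (dot n r) ?vs)" .
qed (rule one_cup_in_ddiagrams[OF n p r])+

definition triangle :: "nat \<Rightarrow> nat \<Rightarrow> deco list" where
  "triangle n i = (if i = 1 then [Btri] else if i = n + 1 then [Wtri] else [])"

text \<open>A one-letter word gives nothing, as both of its decorations stay on the cup and the cap.
  In a longer word each end letter keeps one of its two there.\<close>

fun path_decos :: "nat \<Rightarrow> nat list \<Rightarrow> deco list" where
  "path_decos n (i # j # a) =
     dot n i @ concat (map (triangle n) (butlast (j # a))) @ dot n (last (j # a))"
| "path_decos n a = []"

definition path_diag :: "nat \<Rightarrow> nat list \<Rightarrow> ddiag" where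
  "path_diag n a = one_cup n (hd a) (last a) (dot n (hd a)) (dot n (last a))
     (map (tag n (hd a)) (path_decos n a))"

text \<open>The product adds the dots of \<open>i\<close> and \<open>j\<close> on top. If
  \<open>j\<close> is the last letter, its other dot is still on the cap; otherwise the list for
  \<open>j # a\<close> begins with a dot of \<open>j\<close>, and the two merge into the triangle of
  a letter that has become an inner one.\<close>

lemma diag_class_conc_path:
  assumes n: "n \<ge> 2" and path: "lattice_path n (i # j # a)"
  shows "diag_class n (conc (one_cup n i i (dot n i) (dot n i) []) (path_diag n (j # a))) =
    diag_class n (path_diag n (i # j # a))"
proof -
  define q where "q = last (j # a)"
  have path': "adjacent i j" "lattice_path n (j # a)" "i \<in> {1..n + 1}"
    using path by (simp_all add: lattice_path_Cons)
  from lattice_path_ends[OF path'(2)] have j: "j \<in> {1..n + 1}" and q: "q \<in> {1..n + 1}"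
    by (simp_all add: q_def)
  have conc: "conc (one_cup n i i (dot n i) (dot n i) []) (path_diag n (j # a)) =
      one_cup n i q (dot n i) (dot n q) (map (tag n i) (dot n j @ dot n i @ path_decos n (j # a)))"
    using conc_adjacent[OF n path'(1,3) j q] by (simp add: path_diag_def q_def)
  \<comment> \<open>For n \<ge> 2 the generators 1 and \<open>n + 1\<close> are not adjacent, so at
    most one of the two words is non-empty and their order is immaterial.\<close>
  have dots: "dot n i = [] \<or> dot n j = []"
    using path'(1) n by (auto simp: dot_def adjacent_def)
  show ?thesis
  proof (cases a)
    case Nil
    then show ?thesis
      using dots unfolding conc by (auto simp: path_diag_def q_def)
  next
    case (Cons k b)
    define ds where "ds = concat (map (triangle n) (butlast a)) @ dot n q"
    have decos: "path_decos n (j # a) = dot n j @ ds"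
        "path_decos n (i # j # a) = dot n i @ triangle n j @ ds"
      using Cons by (simp_all add: ds_def q_def)
    show ?thesis
    proof (cases "dot n j = []")
      case True
      then have "triangle n j = []" by (auto simp: dot_def triangle_def split: if_splits)
      then show ?thesis
        unfolding conc unfolding path_diag_def decos using True by (simp add: q_def)
    next
      case False
      then have "\<exists>c t. dot n j = [c] \<and> triangle n j = [t] \<and> deco_rel [c, c] 1 [t]"
        by (auto simp: dot_def triangle_def intro: deco_rel.intros split: if_splits)
      then obtain c t where ct: "dot n j = [c]" "triangle n j = [t]" "deco_rel [c, c] 1 [t]"
        by blast
      have "dot n i = []" using dots False by simp
      then show ?thesis
        using diag_class_merge[OF n path'(3) q ct(3), of ds]
        unfolding conc unfolding path_diag_def decos ct by (simp add: q_def)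
    qed
  qed
qed

lemma theta_TL_word:
  assumes n: "n \<ge> 2" and \<theta>: "is_theta n \<theta>" and path: "lattice_path n a"
  shows "\<theta> (TL_word n a) = diag_class n (path_diag n a)"
  using path
proof (induction a)
  case (Cons i a)
  have i: "i \<in> {1..n + 1}" using Cons.prems by (simp add: lattice_path_Cons)
  have b: "b_gen n i = TL_word n [i]" by (simp add: b_gen_def TL_word_def)
  have gen: "\<theta> (TL_word n [i]) =
      diag_class n (one_cup n i i (dot n i) (dot n i) (map (tag n i) []))"
    unfolding b[symmetric] theta_simps(3)[OF n \<theta> i] d_gen_def simple_diag_dot[OF i] ..
  show ?case
  proof (cases a)
    case Nil
    then show ?thesis using gen by (simp add: path_diag_def)
  next
    case (Cons j a')
    then have a: "lattice_path n a" using Cons.prems by (simp add: lattice_path_Cons)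
    have lists: "[i] \<in> lists {1..n + 1}" "a \<in> lists {1..n + 1}"
      using i a by (auto simp: lattice_path_def)
    have mem: "one_cup n i i (dot n i) (dot n i) (map (tag n i) []) \<in> ddiagrams n"
      "path_diag n a \<in> ddiagrams n"
      unfolding path_diag_def
      by (rule one_cup_in_ddiagrams[OF n i i],
          rule one_cup_in_ddiagrams[OF n lattice_path_ends[OF a]])
    have "\<theta> (TL_word n (i # a)) = \<theta> (TL_word n [i]) \<otimes>\<^bsub>diag_alg n\<^esub> \<theta> (TL_word n a)"
      using theta_simps(1)[OF n \<theta> TL_word_in_carrier[OF lists(1)] TL_word_in_carrier[OF lists(2)]]
        TL_word_mult[OF n lists] by simp
    also have "\<dots> = diag_class n (conc (one_cup n i i (dot n i) (dot n i) []) (path_diag n a))"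
      unfolding gen Cons.IH[OF a] diag_class_mult[OF n \<theta> mem] by simp
    also have "\<dots> = diag_class n (path_diag n (i # a))"
      using diag_class_conc_path[OF n] Cons.prems Cons by simp
    finally show ?thesis .
  qed
qed (simp add: lattice_path_def)

section \<open>The heap order and the decorations prescribed by \<open>decZ\<close>\<close>

lemma heap_less_successively_adjacent:
  assumes "successively adjacent a" "p < q" "q < length a"
  shows "heap_less (mC n) a p q"
proof -
  have step: "mC n (a ! k) (a ! Suc k) \<ge> 3" if "Suc k < length a" for k
  proof -
    have "adjacent (a ! k) (a ! Suc k)"
      using assms(1) that by (simp add: successively_conv_nth)
    then show ?thesis by (auto simp: mC_def adjacent_def)
  qed
  from assms(2,3) show ?thesis
  proof (induction q)
    case (Suc q)
    let ?r = "\<lambda>p q. p < q \<and> q < length a \<and> mC n (a ! p) (a ! q) \<ge> 3"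
    have last: "?r q (Suc q)" using step Suc.prems by simp
    show ?case
    proof (cases "p = q")
      case True
      then show ?thesis unfolding heap_less_def using last by (intro tranclp.r_into_trancl) simp
    next
      case False
      then have "heap_less (mC n) a p q" using Suc by simp
      then show ?thesis unfolding heap_less_def using last by (rule tranclp.trancl_into_trancl)
    qed
  qed simp
qed

lemma heap_less_imp_less: "heap_less m a p q \<Longrightarrow> p < q"
  unfolding heap_less_def by (induction rule: tranclp.induct) auto

text \<open>Consecutive letters do not commute, so the heap is a chain ordered by position, and a
  strictly increasing list is determined by its set of entries.\<close>

lemma end_nodes_successively_adjacent:
  assumes "successively adjacent a"
  shows "end_nodes n a = filter (\<lambda>p. a ! p = 1 \<or> a ! p = n + 1) [0..<length a]"
  unfolding end_nodes_def
proof (rule the_equality)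
  let ?ps = "filter (\<lambda>p. a ! p = 1 \<or> a ! p = n + 1) [0..<length a]"
  have "sorted_wrt (<) ?ps" by (simp add: sorted_wrt_filter)
  then have "sorted_wrt (heap_less (mC n) a) ?ps"
    by (rule sorted_wrt_mono_rel[rotated]) (auto intro: heap_less_successively_adjacent[OF assms])
  then show "set ?ps = {p. p < length a \<and> (a ! p = 1 \<or> a ! p = n + 1)} \<and>
      sorted_wrt (heap_less (mC n) a) ?ps" by auto
next
  fix ps
  assume ps: "set ps = {p. p < length a \<and> (a ! p = 1 \<or> a ! p = n + 1)} \<and>
    sorted_wrt (heap_less (mC n) a) ps"
  then have "sorted_wrt (<) ps"
    using sorted_wrt_mono_rel[of ps "heap_less (mC n) a" "(<)"] heap_less_imp_less by blast
  then show "ps = filter (\<lambda>p. a ! p = 1 \<or> a ! p = n + 1) [0..<length a]"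
    using ps by (intro strict_sorted_equal) (auto simp: sorted_wrt_filter)
qed

lemma replace_last_append [simp]: "replace_last x y (zs @ [x]) = zs @ [y]"
  by (simp add: replace_last_def)

lemma decZ_vert_lattice_path:
  assumes n: "n \<ge> 2" and path: "lattice_path n a" and len: "length a \<ge> 2"
  shows "decZ_vert n a f l = map (\<lambda>c. (if black c then f else l, c)) (path_decos n a)"
proof -
  let ?T = "\<lambda>c. (if black c then f else l, c)"
  let ?g = "\<lambda>s. if s = 1 then (f, Btri) else (l, Wtri)"
  obtain i j b where a: "a = i # j # b"
    using len by (cases a; cases "tl a") auto
  define m q where "m = butlast (j # b)" and "q = last (j # b)"
  have a': "a = i # m @ [q]" by (simp add: a m_def q_def)
  have decos: "path_decos n a = dot n i @ concat (map (triangle n) m) @ dot n q"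
    by (simp add: a m_def q_def)
  have "successively adjacent a" using path by (simp add: lattice_path_def)
  then have "map (\<lambda>p. if a ! p = 1 then (f, Btri) else (l, Wtri)) (end_nodes n a) =
      map ?g (map ((!) a) (filter (\<lambda>p. a ! p = 1 \<or> a ! p = n + 1) [0..<length a]))"
    by (simp add: end_nodes_successively_adjacent)
  also have "map ((!) a) (filter (\<lambda>p. a ! p = 1 \<or> a ! p = n + 1) [0..<length a]) =
      filter (\<lambda>s. s = 1 \<or> s = n + 1) (map ((!) a) [0..<length a])"
    by (simp add: filter_map o_def del: map_nth)
  also have "map ?g (filter (\<lambda>s. s = 1 \<or> s = n + 1) (map ((!) a) [0..<length a])) =
      map ?T (concat (map (triangle n) a))"
    unfolding map_nth by (induction a) (use n in \<open>auto simp: triangle_def\<close>)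
  finally have v0: "map (\<lambda>p. if a ! p = 1 then (f, Btri) else (l, Wtri)) (end_nodes n a) =
      map ?T (triangle n i @ concat (map (triangle n) m) @ triangle n q)"
    by (simp add: a')
  \<comment> \<open>If the word starts with an end generator, its triangle is the first entry, so
    the first match is the intended one.\<close>
  have v1: "(if hd a = 1 then replace_first (f, Btri) (f, Bdot) (map ?T (triangle n i @ ts))
      else if hd a = n + 1 then replace_first (l, Wtri) (l, Wdot) (map ?T (triangle n i @ ts))
      else map ?T (triangle n i @ ts)) = map ?T (dot n i @ ts)" for ts
    using n by (simp add: a triangle_def dot_def)
  \<comment> \<open>Symmetrically the last entry belongs to the last letter; it lies behind the
    entry changed before, which is now part of \<open>ts\<close>.\<close>
  have v2: "(if last a = 1 then replace_last (f, Btri) (f, Bdot) (map ?T (ts @ triangle n q))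
      else if last a = n + 1 then replace_last (l, Wtri) (l, Wdot) (map ?T (ts @ triangle n q))
      else map ?T (ts @ triangle n q)) = map ?T (ts @ dot n q)" for ts
    using n by (simp add: a' triangle_def dot_def)
  show ?thesis
    unfolding decZ_vert_def Let_def v0 v1 decos
    by (rule v2[of "dot n i @ concat (map (triangle n) m)", unfolded append_assoc])
qed

lemma Min_Max_props_one_cup:
  assumes "n \<ge> 2" "p \<in> {1..n + 1}"
  shows "Min (props (one_cup n p r u v vs)) = first_prop p"
    and "Max (props (one_cup n p r u v vs)) = last_prop n p"
  using assms unfolding props_one_cup
  by (intro Min_eqI Max_eqI; auto simp: first_prop_def last_prop_def)+

lemma decZ_cup_neighbours:
  "decZ_cup n p p (Suc p) = dot n p" "decZ_cup n p (Suc p) p = dot n p"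
  by (simp_all add: decZ_cup_def dot_def doubleton_eq_iff)

lemma decZ_lattice_path:
  assumes n: "n \<ge> 2"
    and a: "reduced_expr w = a" "zigzag_expr n w = a" "lattice_path n a" "length a \<ge> 2"
  shows "decZ n w = path_diag n a"
proof -
  note ends = lattice_path_ends[OF a(3)]
  define vs where "vs = map (tag n (hd a)) (path_decos n a)"
  have tau: "d_elt n (tau n w) = one_cup n (hd a) (last a) [] [] []"
    using d_elt_tau[OF n a(3,1)] .
  have vs: "decZ_vert n a (first_prop (hd a)) (last_prop n (hd a)) = vs"
    unfolding decZ_vert_lattice_path[OF n a(3,4)] vs_def tag_def ..
  have word: "decZ_word n a vs x (link (hd a) (last a) x) =
      link_word (hd a) (last a) (dot n (hd a)) (dot n (last a)) vs x" for x
    by (cases x) (simp_all add: decZ_cup_neighbours)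
  show ?thesis
    unfolding decZ_def Let_def a(2) tau Min_Max_props_one_cup[OF n ends(1)]
      vs path_diag_def vs_def[symmetric]
    by (simp add: one_cup_def image_image word)
qed

theorem theorem6p10:
  fixes n :: nat and w :: "nat list set"
    and \<theta> :: "(nat list \<Rightarrow>\<^sub>0 int poly) set \<Rightarrow> (ddiag \<Rightarrow>\<^sub>0 int poly) set"
  assumes "n \<ge> 2"
    and "is_theta n \<theta>"
    and "w \<in> FC_C n"
    and "ZZ n w \<or> PZZ n w"
  shows "diag_class n (decZ n w) = \<theta> (b_elt n w)"
proof -
  obtain a where a: "reduced_expr w = a" "zigzag_expr n w = a" "lattice_path n a" "length a \<ge> 2"
    using zigzag_reduced_expr[OF assms(1,3,4)] .
  have "b_elt n w = TL_word n a"
    unfolding b_elt_def a(1) using a(3)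
    by (intro b_elt_product assms(1)) (simp add: lattice_path_def)
  then show ?thesis
    using theta_TL_word[OF assms(1,2) a(3)] decZ_lattice_path[OF assms(1) a] by simp
qed

end
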